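(* Let $N\ge 1$, $\alpha\in(0,2)$, $\beta\ge 0$, $p>1$, and let $h:(0,\infty)\to(0,\infty)$ with $h\in L^1_{loc}(0,\infty)$. For all $u_0\in L^\infty(\mathbb{R}^N)$ with $u_0\ge 0$, the problem $$\partial_t u+t^{\beta}\mathcal{L}u=-h(t)u^p\quad (x\in\mathbb{R}^N,\ t>0),\qquad u(x,0)=u_0(x)\ge 0\quad (x\in\mathbb{R}^N)$$ has a global solution.
   Context: $\mathcal{L}=-\Delta+(-\Delta)^{\alpha/2}$, where $(-\Delta)^{\alpha/2}$ is the Fourier multiplier with symbol $|\xi|^\alpha$. For $t>0$, $E_\alpha(t)=P_2(t)\ast P_\alpha(t)$ is the heat kernel of $-\mathcal{L}$, where $P_2(t)(x)=(4\pi t)^{-N/2}e^{-|x|^2/(4t)}$ and $P_\alpha(t)(x)=(2\pi)^{-N}\int_{\mathbb{R}^N}e^{ix\cdot\xi-t|\xi|^\alpha}\,d\xi$; convolution with $E_\alpha(0)$ means the identity operator. The nonlinearity $u^p$ is understood as $|u|^{p-1}u$. An $L^\infty(\mathbb{R}^N)$ solution on $[0,T]$ is a function $u\in L^\infty([0,T],L^\infty(\mathbb{R}^N))$ satisfying, for $t\in[0,T]$, the integral equation $$u(t)=E_\alpha\!\left(\tfrac{t^{\beta+1}}{\beta+1}\right)\ast u_0-\int_0^t h(s)\,E_\alpha\!\left(\tfrac{t^{\beta+1}}{\beta+1}-\tfrac{s^{\beta+1}}{\beta+1}\right)\ast\big(|u(s)|^{p-1}u(s)\big)\,ds .$$ A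 global solution is a function on $[0,\infty)$ which is a solution on $[0,T]$ for every $T>0$.
   Formalization: The condition h in L^1_loc(0,∞) is taken to mean that h is integrable on (0,T) for every T>0, including near t=0; if h is not integrable at 0 (e.g. h(t)=1/t), only u_0=0 admits a solution. *)

theory Defs
  imports "HOL-Analysis.Analysis" "HOL-Probability.Essential_Supremum"
begin

definition gauss_kernel :: "real \<Rightarrow> real ^ 'n \<Rightarrow> real" where
  "gauss_kernel t x =
     (4 * pi * t) powr (- (real CARD('n) / 2)) * exp (- ((norm x)\<^sup>2 / (4 * t)))"

text \<open>By the symmetry \<open>\<xi> \<mapsto> - \<xi>\<close> the Fourier integral is real, so \<open>Re\<close> only changes the type.\<close>

definition stable_kernel :: "real \<Rightarrow> real \<Rightarrow> real ^ 'n \<Rightarrow> real" where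
  "stable_kernel \<alpha> t x =
     (2 * pi) powr (- real CARD('n)) *
     Re (LINT \<xi>|lebesgue. exp (\<i> * complex_of_real (x \<bullet> \<xi>) - complex_of_real (t * norm \<xi> powr \<alpha>)))"

definition convol :: "(real ^ 'n \<Rightarrow> real) \<Rightarrow> (real ^ 'n \<Rightarrow> real) \<Rightarrow> real ^ 'n \<Rightarrow> real" where
  "convol f g x = (LINT y|lebesgue. f (x - y) * g y)"

definition heat_kernel :: "real \<Rightarrow> real \<Rightarrow> real ^ 'n \<Rightarrow> real" where
  "heat_kernel \<alpha> t = convol (gauss_kernel t) (stable_kernel \<alpha> t)"

definition heat_op :: "real \<Rightarrow> real \<Rightarrow> (real ^ 'n \<Rightarrow> real) \<Rightarrow> real ^ 'n \<Rightarrow> real" where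
  "heat_op \<alpha> t f = (if t = 0 then f else convol (heat_kernel \<alpha> t) f)"

text \<open>Elements of \<open>L\<^sup>\<infinity>\<close> are represented by functions; identities between them are stated almost
  everywhere.\<close>

definition Linf_norm :: "'a measure \<Rightarrow> ('a \<Rightarrow> real) \<Rightarrow> ereal" where
  "Linf_norm M f = esssup M (\<lambda>x. ereal \<bar>f x\<bar>)"

definition Linf :: "'a measure \<Rightarrow> ('a \<Rightarrow> real) set" where
  "Linf M = {f \<in> borel_measurable M. Linf_norm M f < \<infinity>}"

text \<open>Strong (Bochner) measurability of a map into \<open>L\<^sup>\<infinity>\<close>. The library's measurability and Bochner
  integral for vector-valued maps require a second countable target, which \<open>L\<^sup>\<infinity>\<close> is not.\<close>

definition strongly_measurable_Linf ::
    "'t measure \<Rightarrow> 'a measure \<Rightarrow> ('t \<Rightarrow> 'a \<Rightarrow> real) \<Rightarrow> bool" where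
  "strongly_measurable_Linf K M u \<longleftrightarrow>
     (\<exists>S :: nat \<Rightarrow> 't \<Rightarrow> 'a \<Rightarrow> real.
        (\<forall>k. simple_function K (S k) \<and> (\<forall>t \<in> space K. S k t \<in> Linf M)) \<and>
        (AE t in K. (\<lambda>k. Linf_norm M (\<lambda>x. S k t x - u t x)) \<longlonglongrightarrow> 0))"

definition Linf_Linf :: "'t measure \<Rightarrow> 'a measure \<Rightarrow> ('t \<Rightarrow> 'a \<Rightarrow> real) set" where
  "Linf_Linf K M =
     {u. (\<forall>t \<in> space K. u t \<in> Linf M) \<and> strongly_measurable_Linf K M u \<and>
         (\<exists>C::real. AE t in K. Linf_norm M (u t) \<le> ereal C)}"

definition power_nl :: "real \<Rightarrow> real \<Rightarrow> real" where
  "power_nl p r = \<bar>r\<bar> powr (p - 1) * r"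

definition clock :: "real \<Rightarrow> real \<Rightarrow> real" where
  "clock \<beta> t = t powr (\<beta> + 1) / (\<beta> + 1)"

text \<open>The time integral is taken at each point \<open>x\<close>. For \<open>s < t\<close> the integrand is a bounded uniformly
  continuous function of \<open>x\<close> that depends only on the class of \<open>u s\<close>, and evaluation at \<open>x\<close> is
  continuous on such functions, so this is the Bochner integral in \<open>L\<^sup>\<infinity>\<close>.\<close>

definition Linf_solution ::
    "real \<Rightarrow> real \<Rightarrow> real \<Rightarrow> (real \<Rightarrow> real) \<Rightarrow> (real ^ 'n \<Rightarrow> real) \<Rightarrow> real
     \<Rightarrow> (real \<Rightarrow> real ^ 'n \<Rightarrow> real) \<Rightarrow> bool" where
  "Linf_solution \<alpha> \<beta> p h u0 T u \<longleftrightarrow>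
     u \<in> Linf_Linf (lebesgue_on {0..T}) lebesgue \<and>
     (\<forall>t\<in>{0..T}. AE x in lebesgue.
        set_integrable lebesgue {0<..<t}
          (\<lambda>s. h s * heat_op \<alpha> (clock \<beta> t - clock \<beta> s) (\<lambda>y. power_nl p (u s y)) x) \<and>
        u t x = heat_op \<alpha> (clock \<beta> t) u0 x -
          (LINT s:{0<..<t}|lebesgue.
             h s * heat_op \<alpha> (clock \<beta> t - clock \<beta> s) (\<lambda>y. power_nl p (u s y)) x))"

definition global_solution ::
    "real \<Rightarrow> real \<Rightarrow> real \<Rightarrow> (real \<Rightarrow> real) \<Rightarrow> (real ^ 'n \<Rightarrow> real)
     \<Rightarrow> (real \<Rightarrow> real ^ 'n \<Rightarrow> real) \<Rightarrow> bool" where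
  "global_solution \<alpha> \<beta> p h u0 u \<longleftrightarrow> (\<forall>T>0. Linf_solution \<alpha> \<beta> p h u0 T u)"

text \<open>Local integrability of \<open>h\<close> on the half-line includes integrability at the origin: this is what the
  integral over \<open>(0, t)\<close> in the equation needs, and without it existence fails: for
  \<open>h s = 1 / s\<close> and \<open>u0 = 1\<close> there is no nonnegative solution. The value of \<open>h\<close> outside \<open>(0, \<infinity>)\<close> is never used.\<close>

definition L1_loc_halfline :: "(real \<Rightarrow> real) \<Rightarrow> bool" where
  "L1_loc_halfline h \<longleftrightarrow> (\<forall>T>0. set_integrable lebesgue {0<..<T} h)"

end

theory Submission
  imports Defs "HOL-Probability.Probability"
begin

text \<open>On the interval \<open>[0, M]\<close> with \<open>M\<close> a bound for \<open>u0\<close>, the function \<open>g r = L r - r\<^sup>p\<close> is nonnegative and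
  nondecreasing as soon as \<open>L \<ge> p M\<^sup>p\<^sup>-\<^sup>1\<close>. Writing the equation as \<open>\<partial>\<^sub>t u + t\<^sup>\<beta> \<L> u + L h u = h g(u)\<close> gives a mild
  formulation whose right-hand side is monotone in \<open>u\<close>, so that iteration from \<open>0\<close> increases to a solution
  with values in \<open>[0, M]\<close>; no smallness of time is involved. The semigroup property and Tonelli's theorem turn
  this damped mild equation back into the original one. Continuity of the heat kernel in \<open>L\<^sup>1\<close>
  makes the solution continuous in the sup norm for \<open>t > 0\<close>, hence strongly measurable.

  The argument needs that the heat kernel is nonnegative, has mass one and forms a semigroup. Nonnegativity
  comes from Bernstein's idea: by the binomial series, \<open>((1 - exp(- \<epsilon> r)) / \<epsilon>)\<^sup>\<gamma>\<close> with \<open>0 < \<gamma> < 1\<close> is a constant minus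
  a nonnegative combination of the \<open>exp(- k \<epsilon> r)\<close>. Hence \<open>exp(- t \<bar>\<xi>\<bar>\<^sup>\<alpha>)\<close> is a limit of nonnegative combinations of
  Gaussians. Mass and semigroup follow from Fourier inversion, for which cosine transforms suffice since all
  symbols are even.\<close>

section \<open>Integration over Euclidean space and the Gaussian\<close>

text \<open>The damping term is \<open>L * h t * u\<close> rather than \<open>L * u\<close>. Since
  \<open>h\<close> multiplies the absorption and the damping alike, one constant \<open>L\<close>
  serves all times, however singular the locally integrable \<open>h\<close> is. The integrating
  factor is then \<open>exp (- L * H t)\<close>, with \<open>H t\<close> the integral of
  \<open>h\<close> over (0, t), and \<open>H\<close> acts as a second clock beside the one of the
  diffusion. The iteration takes place in the nonnegative extended reals, where Tonelli's theorem
  and monotone limits need no integrability; the price is that subtraction becomes cancellation of a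
  term known to be finite. Positivity of a transform cannot be tested directly on functions that are
  only bounded, such as the constant 1, so it is tested after multiplication by an arbitrary
  Gaussian. The Laplacian in the operator supplies such a Gaussian for the final symbol, so that the
  regularisation never has to be removed. For a merely bounded \<open>u0\<close> the solution need
  not be continuous in the sup norm at time 0; that single time is a null set for strong
  measurability.\<close>

lemma
  fixes f :: "'a::euclidean_space \<Rightarrow> real \<Rightarrow> 'c::{real_normed_field,banach,second_countable_topology}"
  assumes f: "\<And>b. b \<in> Basis \<Longrightarrow> integrable lborel (f b)"
  shows integrable_lborel_prod_Basis: "integrable lborel (\<lambda>x::'a. \<Prod>b\<in>Basis. f b (x \<bullet> b))"
    and integral_lborel_prod_Basis:
      "(LINT x|(lborel::'a measure). (\<Prod>b\<in>Basis. f b (x \<bullet> b))) = (\<Prod>b\<in>Basis. LINT y|lborel. f b y)"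
proof -
  interpret product_sigma_finite "\<lambda>b::'a. lborel :: real measure"
    by standard
  have m[measurable]: "\<And>b. b \<in> Basis \<Longrightarrow> f b \<in> borel_measurable borel"
    using f by (auto dest: borel_measurable_integrable)
  have m2[measurable]: "(\<lambda>x::'a. \<Prod>b\<in>Basis. f b (x \<bullet> b)) \<in> borel_measurable borel"
    by measurable
  have s: "(\<Prod>b\<in>Basis. f b ((\<Sum>i\<in>Basis. x i *\<^sub>R i) \<bullet> b)) = (\<Prod>b\<in>Basis. f b (x b))" for x :: "'a \<Rightarrow> real"
    by (intro prod.cong refl) (simp add: inner_sum_left inner_Basis if_distrib sum.delta cong: if_cong)
  show "integrable lborel (\<lambda>x::'a. \<Prod>b\<in>Basis. f b (x \<bullet> b))"
    by (subst lborel_eq, subst integrable_distr_eq) (auto simp: s intro!: product_integrable_prod f)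
  show "(LINT x|(lborel::'a measure). (\<Prod>b\<in>Basis. f b (x \<bullet> b))) = (\<Prod>b\<in>Basis. LINT y|lborel. f b y)"
    by (subst lborel_eq, subst integral_distr) (auto simp: s intro!: product_integral_prod f)
qed

lemma nn_integral_lborel_affine:
  fixes f :: "'a::euclidean_space \<Rightarrow> ennreal"
  assumes [measurable]: "f \<in> borel_measurable borel" and "c \<noteq> 0"
  shows "(\<integral>\<^sup>+x. f x \<partial>lborel) = ennreal (\<bar>c\<bar> ^ DIM('a)) * (\<integral>\<^sup>+x. f (t + c *\<^sub>R x) \<partial>lborel)"
  by (subst lborel_affine[OF \<open>c \<noteq> 0\<close>, of t])
     (simp add: nn_integral_density nn_integral_distr nn_integral_cmult)

lemma
  fixes f :: "'a::euclidean_space \<Rightarrow> 'b::{banach, second_countable_topology}"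
  assumes f: "integrable lborel f" and c: "c \<noteq> 0"
  shows integrable_lborel_affine: "integrable lborel (\<lambda>x. f (t + c *\<^sub>R x))"
    and integral_lborel_affine:
      "(LINT x|lborel. f x) = (\<bar>c\<bar> ^ DIM('a)) *\<^sub>R (LINT x|lborel. f (t + c *\<^sub>R x))"
proof -
  have [measurable]: "f \<in> borel_measurable borel"
    using f by (auto dest: borel_measurable_integrable)
  have "(\<integral>\<^sup>+x. norm (f x) \<partial>lborel) < \<infinity>"
    using f by (simp add: integrable_iff_bounded)
  then have "(\<integral>\<^sup>+x. norm (f (t + c *\<^sub>R x)) \<partial>lborel) < \<infinity>"
    using c by (subst (asm) nn_integral_lborel_affine[where c=c and t=t])
      (auto simp: ennreal_mult_less_top simp flip: ennreal_0)
  then show i: "integrable lborel (\<lambda>x. f (t + c *\<^sub>R x))"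
    by (simp add: integrable_iff_bounded)
  show "(LINT x|lborel. f x) = (\<bar>c\<bar> ^ DIM('a)) *\<^sub>R (LINT x|lborel. f (t + c *\<^sub>R x))"
    using i by (subst lborel_affine[OF c, of t]) (simp add: integral_density integral_distr)
qed

lemma char_gauss_1d:
  fixes a x :: real
  assumes a: "0 < a"
  shows "integrable lborel (\<lambda>y. exp (\<i> * complex_of_real (x * y)) * complex_of_real (exp (- a * y\<^sup>2)))"
    and "(LINT y|lborel. exp (\<i> * complex_of_real (x * y)) * complex_of_real (exp (- a * y\<^sup>2))) =
      complex_of_real (sqrt (pi / a) * exp (- (x\<^sup>2 / (4 * a))))"
proof -
  \<comment> \<open>With z = y / s the exponent a y^2 becomes z^2 / 2, and the integral becomes the
    characteristic function of the standard normal law at \<open>x * s\<close>.\<close>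
  define s where "s = 1 / sqrt (2 * a)"
  have s: "s > 0" "s\<^sup>2 = 1 / (2 * a)"
    using a by (auto simp: s_def power_divide)
  define F where "F = (\<lambda>z. exp (\<i> * complex_of_real (x * s * z)) * complex_of_real (std_normal_density z))"
  have F: "integrable lborel F"
    unfolding F_def
    by (rule Bochner_Integration.integrable_bound[OF integrable_std_normal_moment[of 0]]) 
       (auto simp: norm_mult)
  have "(LINT z|lborel. F z) = char std_normal_distribution (x * s)"
    unfolding char_def F_def
    by (subst integral_density) (auto simp: scaleR_conv_of_real mult.commute cis_conv_exp)
  also have "\<dots> = complex_of_real (exp (- ((x * s)\<^sup>2) / 2))"
    by (simp add: char_std_normal_distribution)
  also have "(x * s)\<^sup>2 = x\<^sup>2 / (2 * a)"
    using s by (simp add: power_mult_distrib)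
  finally have I: "(LINT z|lborel. F z) = complex_of_real (exp (- (x\<^sup>2 / (4 * a))))"
    by simp
  have eq: "exp (\<i> * complex_of_real (x * y)) * complex_of_real (exp (- a * y\<^sup>2)) =
     complex_of_real (sqrt (2 * pi)) * F (0 + (1 / s) * y)" for y
  proof -
    have "- (1 / s * y)\<^sup>2 / 2 = - a * y\<^sup>2"
      using s a by (simp add: power_mult_distrib power_divide)
    then show ?thesis
      using s unfolding F_def std_normal_density_def by simp
  qed
  show "integrable lborel (\<lambda>y. exp (\<i> * complex_of_real (x * y)) * complex_of_real (exp (- a * y\<^sup>2)))"
    unfolding eq using s
    by (intro integrable_mult_right lborel_integrable_real_affine F) auto
  have "(LINT z|lborel. F z) = \<bar>1 / s\<bar> *\<^sub>R (LINT y|lborel. F (0 + (1 / s) * y))"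
    using s by (intro lborel_integral_real_affine) auto
  then have "(LINT y|lborel. F (0 + (1 / s) * y)) = s *\<^sub>R complex_of_real (exp (- (x\<^sup>2 / (4 * a))))"
    using s unfolding I by (simp add: field_simps scaleR_conv_of_real)
  moreover have "sqrt (2 * pi) * s = sqrt (pi / a)"
    using a by (simp add: s_def real_sqrt_mult real_sqrt_divide)
  ultimately show "(LINT y|lborel. exp (\<i> * complex_of_real (x * y)) * complex_of_real (exp (- a * y\<^sup>2))) =
      complex_of_real (sqrt (pi / a) * exp (- (x\<^sup>2 / (4 * a))))"
    unfolding eq by (simp add: scaleR_conv_of_real flip: of_real_mult)
qed

text \<open>Unnormalised: applied twice to a suitable even \<open>m\<close> it returns
  \<open>(2 * pi) ^ DIM('a) * m\<close>. For an even integrable function it is the Fourier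
  transform.\<close>

definition cos_transform :: "('a::euclidean_space \<Rightarrow> real) \<Rightarrow> 'a \<Rightarrow> real" where
  "cos_transform f x = (LINT y|lborel. cos (x \<bullet> y) * f y)"

text \<open>The complex exponential factors over the coordinates, which the cosine does not; hence
  the detour through the one-dimensional complex integral, with the real part taken only at the
  end.\<close>

lemma
  fixes a :: real and x :: "'a::euclidean_space"
  assumes a: "0 < a"
  shows integrable_gauss: "integrable lborel (\<lambda>y::'a. exp (- a * (norm y)\<^sup>2))"
    and cos_transform_gauss: "cos_transform (\<lambda>y. exp (- a * (norm y)\<^sup>2)) x =
      (pi / a) powr (DIM('a) / 2) * exp (- ((norm x)\<^sup>2 / (4 * a)))"
proof -
  let ?f = "\<lambda>(x::'a) b y. exp (\<i> * complex_of_real ((x \<bullet> b) * y)) * complex_of_real (exp (- a * y\<^sup>2))"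
  have nrm: "(norm y)\<^sup>2 = (\<Sum>b\<in>Basis. (y \<bullet> b)\<^sup>2)" for y :: 'a
    by (subst euclidean_inner[of y y, folded power2_norm_eq_inner]) (simp add: power2_eq_square)
  have P: "(\<Prod>b\<in>Basis. ?f x b (y \<bullet> b)) = exp (\<i> * complex_of_real (x \<bullet> y)) * complex_of_real (exp (- a * (norm y)\<^sup>2))" for x y :: 'a
    by (simp add: prod.distrib euclidean_inner[of x y] nrm sum_distrib_left exp_sum flip: of_real_prod sum_negf)
  have int: "integrable lborel (\<lambda>y::'a. exp (\<i> * complex_of_real (x \<bullet> y)) * complex_of_real (exp (- a * (norm y)\<^sup>2)))" for x :: 'a
    unfolding P[symmetric] by (intro integrable_lborel_prod_Basis char_gauss_1d a)
  show ig: "integrable lborel (\<lambda>y::'a. exp (- a * (norm y)\<^sup>2))"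
    using integrable_Re[OF int[of 0]] by simp
  have "(LINT y|lborel. exp (\<i> * complex_of_real (x \<bullet> y)) * complex_of_real (exp (- a * (norm y)\<^sup>2))) =
     (\<Prod>b\<in>Basis. complex_of_real (sqrt (pi / a) * exp (- ((x \<bullet> b)\<^sup>2 / (4 * a)))))"
    unfolding P[symmetric]
    by (subst integral_lborel_prod_Basis, rule char_gauss_1d(1)[OF a], rule prod.cong[OF refl char_gauss_1d(2)[OF a]])
  also have "\<dots> = complex_of_real (sqrt (pi / a) ^ DIM('a) * exp (- ((norm x)\<^sup>2 / (4 * a))))"
    by (simp add: prod.distrib nrm exp_sum sum_divide_distrib flip: of_real_prod sum_negf)
  also have "sqrt (pi / a) ^ DIM('a) = (pi / a) powr (DIM('a) / 2)"
    using a by (simp add: powr_half_sqrt[symmetric] powr_realpow[symmetric] powr_powr)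
  finally have c: "(LINT y|lborel. exp (\<i> * complex_of_real (x \<bullet> y)) * complex_of_real (exp (- a * (norm y)\<^sup>2))) =
     complex_of_real ((pi / a) powr (DIM('a) / 2) * exp (- ((norm x)\<^sup>2 / (4 * a))))" .
  have "cos_transform (\<lambda>y. exp (- a * (norm y)\<^sup>2)) x =
     (LINT y|lborel. Re (exp (\<i> * complex_of_real (x \<bullet> y)) * complex_of_real (exp (- a * (norm y)\<^sup>2))))"
    unfolding cos_transform_def by (simp add: Re_exp)
  also have "\<dots> = Re (complex_of_real ((pi / a) powr (DIM('a) / 2) * exp (- ((norm x)\<^sup>2 / (4 * a)))))"
    by (subst integral_Re[OF int]) (simp only: c)
  finally show "cos_transform (\<lambda>y. exp (- a * (norm y)\<^sup>2)) x =
      (pi / a) powr (DIM('a) / 2) * exp (- ((norm x)\<^sup>2 / (4 * a)))"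
    by simp
qed


section \<open>Integrability of stretched exponentials\<close>

lemma power_div_fact_le_exp:
  fixes y :: real
  assumes "0 \<le> y"
  shows "y ^ k / fact k \<le> exp y"
proof -
  have "(\<Sum>n\<in>{k}. inverse (fact n) * y ^ n) \<le> (\<Sum>n. inverse (fact n) * y ^ n)"
    using assms by (intro sum_le_suminf summable_exp) auto
  then show ?thesis
    by (simp add: exp_def divide_inverse mult.commute)
qed

lemma integrable_exp_powr_1d:
  fixes c \<alpha> :: real
  assumes c: "0 < c" and \<alpha>: "0 < \<alpha>"
  shows "integrable lborel (\<lambda>x::real. exp (- c * \<bar>x\<bar> powr \<alpha>))"
proof -
  \<comment> \<open>With \<alpha> k \<ge> 2, the k-th term of the exponential series already grows
    at least like x^2 outside the unit interval, so 1 / (1 + x^2) is a majorant up to a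
    constant.\<close>
  obtain k :: nat where k: "2 / \<alpha> \<le> real k"
    using real_arch_simple by blast
  \<comment> \<open>The summand 1 covers |x| \<le> 1, the quotient covers |x| > 1.\<close>
  define C where "C = 1 + fact k / c ^ k"
  have C: "C \<ge> 1" "C \<ge> fact k / c ^ k"
    using c by (auto simp: C_def)
  have bound: "exp (- c * \<bar>x\<bar> powr \<alpha>) \<le> 2 * C * inverse (1 + x\<^sup>2)" for x :: real
  proof (cases "\<bar>x\<bar> \<le> 1")
    case True
    have "exp (- c * \<bar>x\<bar> powr \<alpha>) \<le> 1"
      using c by simp
    also have "1 + x\<^sup>2 \<le> 2 * C"
      using True C abs_square_le_1[of x] by simp
    then have "1 \<le> 2 * C * inverse (1 + x\<^sup>2)"
      by (simp add: field_simps add_pos_nonneg)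
    finally show ?thesis .
  next
    case False
    let ?y = "c * \<bar>x\<bar> powr \<alpha>"
    have "x\<^sup>2 = \<bar>x\<bar> powr 2"
      using False by (simp add: powr_numeral)
    also have "\<dots> \<le> \<bar>x\<bar> powr (\<alpha> * real k)"
      using False k \<alpha> by (intro powr_mono) (auto simp: field_simps)
    finally have x2: "x\<^sup>2 \<le> (\<bar>x\<bar> powr \<alpha>) ^ k"
      using False by (simp add: powr_powr[symmetric] powr_realpow)
    have "c ^ k * x\<^sup>2 / fact k \<le> ?y ^ k / fact k"
      using x2 c by (simp add: power_mult_distrib divide_right_mono)
    also have "\<dots> \<le> exp ?y"
      using c by (intro power_div_fact_le_exp) auto
    finally have e: "c ^ k * x\<^sup>2 / fact k \<le> exp ?y" .
    have x1: "1 \<le> x\<^sup>2"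
      using False abs_le_square_iff[of 1 x] by simp
    have "1 + x\<^sup>2 \<le> 2 * x\<^sup>2"
      using x1 by simp
    also have "\<dots> = 2 * (fact k / c ^ k) * (c ^ k * x\<^sup>2 / fact k)"
      using c by simp
    also have "\<dots> \<le> 2 * C * exp ?y"
      using C c e by (intro mult_mono) auto
    finally have "1 + x\<^sup>2 \<le> 2 * C * exp ?y" .
    then show ?thesis
      by (simp add: exp_minus field_simps add_pos_nonneg)
  qed
  have "integrable lborel (\<lambda>x::real. 2 * C * inverse (1 + x\<^sup>2))"
    using integrable_inverse_1_plus_square by (intro integrable_mult_right) (simp add: set_integrable_def)
  then show ?thesis
    by (rule Bochner_Integration.integrable_bound) (use C bound in \<open>auto simp: abs_mult\<close>)
qed

text \<open>Each coordinate is at most the norm, so distributing \<open>t\<close> equally over the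
  coordinates gives a product of one-dimensional integrable functions as a majorant.\<close>

lemma integrable_exp_norm_powr:
  fixes t \<alpha> :: real
  assumes t: "0 < t" and \<alpha>: "0 < \<alpha>"
  shows "integrable lborel (\<lambda>x::'a::euclidean_space. exp (- t * norm x powr \<alpha>))"
proof -
  let ?c = "t / DIM('a)"
  have "integrable lborel (\<lambda>x::'a. \<Prod>b\<in>Basis. exp (- ?c * \<bar>x \<bullet> b\<bar> powr \<alpha>))"
    using t \<alpha> by (intro integrable_lborel_prod_Basis integrable_exp_powr_1d) auto
  then show ?thesis
  proof (rule Bochner_Integration.integrable_bound)
    show "AE x::'a in lborel. norm (exp (- t * norm x powr \<alpha>)) \<le> norm (\<Prod>b\<in>Basis. exp (- ?c * \<bar>x \<bullet> b\<bar> powr \<alpha>))"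
    proof (rule AE_I2)
      fix x :: 'a
      have "(\<Sum>b\<in>(Basis::'a set). ?c * \<bar>x \<bullet> b\<bar> powr \<alpha>) \<le> (\<Sum>b\<in>(Basis::'a set). ?c * norm x powr \<alpha>)"
        using t \<alpha> Basis_le_norm by (intro sum_mono mult_left_mono powr_mono2) auto
      then show "norm (exp (- t * norm x powr \<alpha>)) \<le> norm (\<Prod>b\<in>Basis. exp (- ?c * \<bar>x \<bullet> b\<bar> powr \<alpha>))"
        by (simp add: exp_sum[symmetric] sum_negf)
    qed
  qed measurable
qed

section \<open>The cosine transform\<close>

text \<open>Licenses Fubini's theorem below, where \<open>w\<close> is a cosine or a product of two
  cosines.\<close>

lemma integrable_pair_mult_bounded:
  fixes f :: "'a::euclidean_space \<Rightarrow> real" and g :: "'b::euclidean_space \<Rightarrow> real"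
  assumes f: "integrable lborel f" and g: "integrable lborel g"
    and [measurable]: "(\<lambda>(x, y). w x y) \<in> borel_measurable (borel \<Otimes>\<^sub>M borel)"
    and w: "\<And>x y. \<bar>w x y\<bar> \<le> 1"
  shows "integrable (lborel \<Otimes>\<^sub>M lborel) (\<lambda>(x, y). f x * g y * w x y)"
proof -
  have [measurable]: "f \<in> borel_measurable borel" "g \<in> borel_measurable borel"
    using f g by (auto dest: borel_measurable_integrable)
  have "(\<integral>\<^sup>+z. norm (case z of (x, y) \<Rightarrow> f x * g y) \<partial>(lborel \<Otimes>\<^sub>M lborel)) =
      (\<integral>\<^sup>+x. \<integral>\<^sup>+y. ennreal \<bar>f x\<bar> * ennreal \<bar>g y\<bar> \<partial>lborel \<partial>lborel)"
    by (subst lborel.nn_integral_fst[symmetric]) (simp_all add: abs_mult ennreal_mult)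
  also have "\<dots> = (\<integral>\<^sup>+x. ennreal \<bar>f x\<bar> \<partial>lborel) * (\<integral>\<^sup>+y. ennreal \<bar>g y\<bar> \<partial>lborel)"
    by (simp add: nn_integral_cmult nn_integral_multc)
  also have "\<dots> < \<infinity>"
    using f g by (simp add: integrable_iff_bounded ennreal_mult_less_top)
  finally have "integrable (lborel \<Otimes>\<^sub>M lborel) (\<lambda>(x, y). f x * g y)"
    by (simp add: integrable_iff_bounded)
  then show ?thesis
  proof (rule Bochner_Integration.integrable_bound)
    have "\<bar>f x * g y * w x y\<bar> \<le> \<bar>f x * g y\<bar>" for x y
      using mult_left_le[OF w[of x y], of "\<bar>f x * g y\<bar>"] by (simp add: abs_mult)
    then show "AE z in lborel \<Otimes>\<^sub>M lborel. norm (case z of (x, y) \<Rightarrow> f x * g y * w x y) \<le> norm (case z of (x, y) \<Rightarrow> f x * g y)"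
      by (intro AE_I2) auto
  qed measurable
qed

lemma integrable_mult_bounded:
  fixes f g :: "'a::euclidean_space \<Rightarrow> real"
  assumes "integrable lborel f" "g \<in> borel_measurable borel" "\<And>x. \<bar>g x\<bar> \<le> B"
  shows "integrable lborel (\<lambda>x. g x * f x)"
proof -
  have "integrable lborel (\<lambda>x. B * f x)"
    using assms by simp
  then show ?thesis
  proof (rule Bochner_Integration.integrable_bound)
    have "\<bar>g x * f x\<bar> \<le> \<bar>B * f x\<bar>" for x
      using assms(3)[of x] by (auto simp: abs_mult intro!: mult_right_mono)
    then show "AE x in lborel. norm (g x * f x) \<le> norm (B * f x)"
      by simp
  qed (use assms in \<open>auto dest: borel_measurable_integrable\<close>)
qed

lemma integral_lborel_reflect:
  fixes f :: "'a::euclidean_space \<Rightarrow> real"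
  assumes f: "integrable lborel f"
  shows "(LINT y|lborel. f (t - y)) = (LINT y|lborel. f y)" "integrable lborel (\<lambda>y. f (t - y))"
  using integral_lborel_affine[OF f, of "-1" t] integrable_lborel_affine[OF f, of "-1" t] by auto

lemma integral_odd_eq_0:
  fixes f :: "'a::euclidean_space \<Rightarrow> real"
  assumes "\<And>y. f (- y) = - f y"
  shows "(LINT y|lborel. f y) = 0"
\<comment> \<open>Without integrability the integral is 0 by its default value.\<close>
proof (cases "integrable lborel f")
  case True
  then show ?thesis
    using integral_lborel_reflect(1)[OF True, of 0] assms by simp
qed (simp add: not_integrable_integral_eq)

lemma cos_transform_measurable[measurable]:
  fixes f :: "'a::euclidean_space \<Rightarrow> real"
  assumes [measurable]: "f \<in> borel_measurable borel"
  shows "cos_transform f \<in> borel_measurable borel"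
  unfolding cos_transform_def[abs_def] by measurable

lemma cos_transform_even: "cos_transform f (- x) = cos_transform f x"
  by (simp add: cos_transform_def)

lemma cos_transform_bound:
  fixes f :: "'a::euclidean_space \<Rightarrow> real"
  assumes f: "integrable lborel f"
  shows "\<bar>cos_transform f x\<bar> \<le> (LINT y|lborel. \<bar>f y\<bar>)"
proof -
  have "\<bar>cos_transform f x\<bar> \<le> (LINT y|lborel. \<bar>cos (x \<bullet> y) * f y\<bar>)"
    unfolding cos_transform_def by (rule integral_abs_bound)
  also have "\<dots> \<le> (LINT y|lborel. \<bar>f y\<bar>)"
    using f by (intro integral_mono integrable_abs integrable_mult_bounded[where B=1])
      (auto simp: abs_mult intro!: mult_left_le_one_le)
  finally show ?thesis .
qed

lemma integrable_cos_mult: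
  fixes f :: "'a::euclidean_space \<Rightarrow> real"
  assumes f: "integrable lborel f"
  shows "integrable lborel (\<lambda>y. cos (x \<bullet> y) * f y)" "integrable lborel (\<lambda>y. sin (x \<bullet> y) * f y)"
  by (intro integrable_mult_bounded[OF f, where B=1]; simp)+

text \<open>The convolution theorem, with one factor given by its transform. After Fubini, the
  addition formula splits the cosine of a difference; the sine part integrates to 0 against the even
  \<open>f\<close>.\<close>

lemma cos_transform_convolution:
  fixes f m :: "'a::euclidean_space \<Rightarrow> real"
  assumes f: "integrable lborel f" and m: "integrable lborel m" and even: "\<And>y. f (- y) = f y"
  shows "(LINT y|lborel. f y * cos_transform m (x - y)) = cos_transform (\<lambda>\<xi>. cos_transform f \<xi> * m \<xi>) x"
proof -
  have [measurable]: "f \<in> borel_measurable borel" "m \<in> borel_measurable borel"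
    using f m by (auto dest: borel_measurable_integrable)
  have "(LINT y|lborel. f y * cos_transform m (x - y)) =
      (LINT y|lborel. LINT \<xi>|lborel. f y * m \<xi> * cos ((x - y) \<bullet> \<xi>))"
    unfolding cos_transform_def integral_mult_right_zero[symmetric] by (simp add: mult_ac)
  also have "\<dots> = (LINT \<xi>|lborel. LINT y|lborel. f y * m \<xi> * cos ((x - y) \<bullet> \<xi>))"
    by (intro lborel_pair.Fubini_integral[symmetric] integrable_pair_mult_bounded f m) auto
  also have "\<dots> = (LINT \<xi>|lborel. cos (x \<bullet> \<xi>) * (cos_transform f \<xi> * m \<xi>))"
  proof (intro Bochner_Integration.integral_cong refl)
    fix \<xi>
    have "(LINT y|lborel. f y * m \<xi> * cos ((x - y) \<bullet> \<xi>)) =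
      (LINT y|lborel. (cos (x \<bullet> \<xi>) * m \<xi>) * (cos (\<xi> \<bullet> y) * f y) + (sin (x \<bullet> \<xi>) * m \<xi>) * (sin (\<xi> \<bullet> y) * f y))"
      by (simp add: inner_diff_left cos_diff algebra_simps inner_commute)
    also have "\<dots> = (cos (x \<bullet> \<xi>) * m \<xi>) * cos_transform f \<xi> + (sin (x \<bullet> \<xi>) * m \<xi>) * (LINT y|lborel. sin (\<xi> \<bullet> y) * f y)"
      unfolding cos_transform_def using f by (simp add: integrable_cos_mult)
    also have "(LINT y|lborel. sin (\<xi> \<bullet> y) * f y) = 0"
      by (rule integral_odd_eq_0) (simp add: even)
    finally show "(LINT y|lborel. f y * m \<xi> * cos ((x - y) \<bullet> \<xi>)) = cos (x \<bullet> \<xi>) * (cos_transform f \<xi> * m \<xi>)"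
      by simp
  qed
  finally show ?thesis
    by (simp add: cos_transform_def)
qed

text \<open>The multiplication formula with a modulation. The product of cosines is half the sum of
  those at \<xi> - \<eta> and \<xi> + \<eta>, and evenness of \<open>m\<close> makes both halves
  equal.\<close>

lemma cos_transform_regularised:
  fixes f m :: "'a::euclidean_space \<Rightarrow> real"
  assumes f: "integrable lborel f" and m: "integrable lborel m" and even: "\<And>y. m (- y) = m y"
  shows "(LINT y|lborel. f y * cos (\<xi> \<bullet> y) * cos_transform m y) =
    (LINT \<eta>|lborel. cos_transform f (\<xi> - \<eta>) * m \<eta>)"
proof -
  have [measurable]: "f \<in> borel_measurable borel" "m \<in> borel_measurable borel"
    using f m by (auto dest: borel_measurable_integrable)
  have b: "\<bar>cos (\<xi> \<bullet> y) * cos (y \<bullet> \<eta>)\<bar> \<le> 1" for y \<eta>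
    by (simp add: abs_mult mult_le_one)
  have i: "integrable lborel (\<lambda>\<eta>. cos_transform f (\<xi> - \<eta>) * m \<eta>)" "integrable lborel (\<lambda>\<eta>. cos_transform f (\<xi> + \<eta>) * m \<eta>)"
    by (intro integrable_mult_bounded[OF m _ cos_transform_bound[OF f]]; simp)+
  have "(LINT y|lborel. f y * cos (\<xi> \<bullet> y) * cos_transform m y) =
     (LINT y|lborel. LINT \<eta>|lborel. f y * m \<eta> * (cos (\<xi> \<bullet> y) * cos (y \<bullet> \<eta>)))"
    unfolding cos_transform_def integral_mult_right_zero[symmetric] by (simp add: mult_ac)
  also have "\<dots> = (LINT \<eta>|lborel. LINT y|lborel. f y * m \<eta> * (cos (\<xi> \<bullet> y) * cos (y \<bullet> \<eta>)))"
    by (intro lborel_pair.Fubini_integral[symmetric] integrable_pair_mult_bounded f m b) auto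
  also have "\<dots> = (LINT \<eta>|lborel. (1/2) * (cos_transform f (\<xi> - \<eta>) * m \<eta>) + (1/2) * (cos_transform f (\<xi> + \<eta>) * m \<eta>))"
  proof (intro Bochner_Integration.integral_cong refl)
    fix \<eta>
    have "(LINT y|lborel. f y * m \<eta> * (cos (\<xi> \<bullet> y) * cos (y \<bullet> \<eta>))) =
      (LINT y|lborel. (m \<eta> / 2) * (cos ((\<xi> - \<eta>) \<bullet> y) * f y) + (m \<eta> / 2) * (cos ((\<xi> + \<eta>) \<bullet> y) * f y))"
      by (intro Bochner_Integration.integral_cong refl)
         (simp add: inner_diff_left inner_add_left cos_diff cos_add algebra_simps inner_commute)
    then show "(LINT y|lborel. f y * m \<eta> * (cos (\<xi> \<bullet> y) * cos (y \<bullet> \<eta>))) =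
       (1/2) * (cos_transform f (\<xi> - \<eta>) * m \<eta>) + (1/2) * (cos_transform f (\<xi> + \<eta>) * m \<eta>)"
      unfolding cos_transform_def using f by (simp add: integrable_cos_mult) (simp add: mult.commute)
  qed
  also have "\<dots> = (1/2) * (LINT \<eta>|lborel. cos_transform f (\<xi> - \<eta>) * m \<eta>) + (1/2) * (LINT \<eta>|lborel. cos_transform f (\<xi> + \<eta>) * m \<eta>)"
    using i by simp
  also have "(LINT \<eta>|lborel. cos_transform f (\<xi> + \<eta>) * m \<eta>) = (LINT \<eta>|lborel. cos_transform f (\<xi> - \<eta>) * m \<eta>)"
    using integral_lborel_reflect(1)[OF i(2), of 0] by (simp add: even)
  finally show ?thesis
    by simp
qed

text \<open>Gauss summation of the inversion integral: the multiplication formula moves the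
  transform onto the widening Gaussian, where it becomes an approximate identity that concentrates
  at \<xi>.\<close>

lemma gauss_regularised_limit:
  fixes m :: "'a::euclidean_space \<Rightarrow> real"
  assumes m: "integrable lborel m" and even: "\<And>y. m (- y) = m y"
    and cont: "continuous_on UNIV m" and bound: "\<And>y. \<bar>m y\<bar> \<le> B"
  shows "(\<lambda>n. LINT y|lborel. exp (- (1 / Suc n) * (norm y)\<^sup>2) * cos (\<xi> \<bullet> y) * cos_transform m y)
    \<longlonglongrightarrow> (2 * pi) ^ DIM('a) * m \<xi>"
proof -
  have [measurable]: "m \<in> borel_measurable borel"
    using m by (auto dest: borel_measurable_integrable)
  define G where "G = (\<lambda>w::'a. exp (- 1 * (norm w)\<^sup>2))"
  have G: "integrable lborel G"
    unfolding G_def by (rule integrable_gauss) simp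
  have [measurable]: "G \<in> borel_measurable borel"
    using G by (auto dest: borel_measurable_integrable)
  \<comment> \<open>The value of
    \<open>?d n ^ DIM('a) * (pi / ?\<delta>) powr (DIM('a) / 2)\<close>: the Jacobian and the factor
    of the transformed Gaussian compensate each other, so no n remains.\<close>
  define c where "c = (4 * pi) powr (DIM('a) / 2)"
  \<comment> \<open>The width of the transformed Gaussian: rescaling by it turns exp(- |\<xi> -
    \<eta>|^2 / (4 \<delta>)) into the fixed function \<open>G\<close>.\<close>
  let ?d = "\<lambda>n::nat. 2 * sqrt (1 / Suc n)"
  have eq: "(LINT y|lborel. exp (- (1 / Suc n) * (norm y)\<^sup>2) * cos (\<xi> \<bullet> y) * cos_transform m y) =
     c * (LINT w|lborel. m (\<xi> - ?d n *\<^sub>R w) * G w)" for n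
  proof -
    let ?\<delta> = "1 / real (Suc n)"
    have pos: "?d n > 0" by simp
    let ?h = "\<lambda>\<eta>. cos_transform (\<lambda>y::'a. exp (- ?\<delta> * (norm y)\<^sup>2)) (\<xi> - \<eta>) * m \<eta>"
    have ig: "integrable lborel (\<lambda>y::'a. exp (- ?\<delta> * (norm y)\<^sup>2))"
      by (rule integrable_gauss) simp
    have i: "integrable lborel ?h"
      by (intro integrable_mult_bounded[OF m _ cos_transform_bound[OF ig]]) simp
    have "(LINT y|lborel. exp (- (1 / Suc n) * (norm y)\<^sup>2) * cos (\<xi> \<bullet> y) * cos_transform m y) =
       (LINT \<eta>|lborel. ?h \<eta>)"
      using cos_transform_regularised[OF ig m even] by simp
    also have "\<dots> = ?d n ^ DIM('a) * (LINT w|lborel. ?h (\<xi> + (- ?d n) *\<^sub>R w))"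
      using integral_lborel_affine[OF i, of "- ?d n" \<xi>] pos by simp
    also have "\<dots> = ?d n ^ DIM('a) * (LINT w|lborel. (pi / ?\<delta>) powr (DIM('a) / 2) * (m (\<xi> - ?d n *\<^sub>R w) * G w))"
    proof -
      have "?h (\<xi> + (- ?d n) *\<^sub>R w) = (pi / ?\<delta>) powr (DIM('a) / 2) * (m (\<xi> - ?d n *\<^sub>R w) * G w)" for w
        by (subst cos_transform_gauss) (simp_all add: G_def power_mult_distrib power_divide)
      then show ?thesis by (simp only:)
    qed
    also have "\<dots> = (?d n ^ DIM('a) * (pi / ?\<delta>) powr (DIM('a) / 2)) * (LINT w|lborel. m (\<xi> - ?d n *\<^sub>R w) * G w)"
      by simp
    also have "?d n ^ DIM('a) * (pi / ?\<delta>) powr (DIM('a) / 2) = c"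
    proof -
      have "?d n = (4 * ?\<delta>) powr (1/2)"
        by (simp add: powr_half_sqrt real_sqrt_mult real_sqrt_divide)
      then have "?d n ^ DIM('a) = (4 * ?\<delta>) powr (DIM('a) / 2)"
        by (simp add: powr_realpow[symmetric] powr_powr)
      then show ?thesis
        by (simp add: c_def powr_mult[symmetric])
    qed
    finally show ?thesis .
  qed
  have "(\<lambda>n. LINT w|lborel. m (\<xi> - ?d n *\<^sub>R w) * G w) \<longlonglongrightarrow> (LINT w|lborel. m \<xi> * G w)"
  proof (rule integral_dominated_convergence[where w="\<lambda>w. B * G w"])
    have "(\<lambda>n. ?d n) \<longlonglongrightarrow> 2 * sqrt 0"
      by (intro tendsto_mult tendsto_real_sqrt tendsto_const LIMSEQ_inverse_real_of_nat[unfolded inverse_eq_divide])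
    then have "(\<lambda>n. \<xi> - ?d n *\<^sub>R w) \<longlonglongrightarrow> \<xi> - 0 *\<^sub>R w" for w
      by (intro tendsto_intros) simp
    then show "AE w in lborel. (\<lambda>n. m (\<xi> - ?d n *\<^sub>R w) * G w) \<longlonglongrightarrow> m \<xi> * G w"
      using cont by (intro AE_I2 tendsto_mult tendsto_const continuous_on_tendsto_compose[OF cont]) simp_all
    show "AE w in lborel. norm (m (\<xi> - ?d n *\<^sub>R w) * G w) \<le> B * G w" for n
      using bound by (auto simp: abs_mult G_def intro!: mult_right_mono)
  qed (use G in auto)
  then have "(\<lambda>n. c * (LINT w|lborel. m (\<xi> - ?d n *\<^sub>R w) * G w)) \<longlonglongrightarrow> c * (m \<xi> * (LINT w|lborel. G w))"
    by (intro tendsto_mult tendsto_const) simp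
  moreover have "(LINT w|lborel. G w) = pi powr (DIM('a) / 2)"
    using cos_transform_gauss[of 1 "0::'a"] by (simp add: cos_transform_def G_def)
  moreover have "c * pi powr (DIM('a) / 2) = (2 * pi) ^ DIM('a)"
  proof -
    have "c * pi powr (DIM('a) / 2) = ((2 * pi) powr 2) powr (DIM('a) / 2)"
      unfolding c_def by (subst powr_mult[symmetric]) (simp_all add: power2_eq_square powr_numeral mult.assoc)
    then show ?thesis
      by (simp only: powr_powr) (simp add: powr_realpow)
  qed
  from arg_cong[OF this, of "\<lambda>z. z * m \<xi>"]
  have "c * (m \<xi> * pi powr (DIM('a) / 2)) = (2 * pi) ^ DIM('a) * m \<xi>"
    by (simp only: mult_ac)
  ultimately have "(\<lambda>n. c * (LINT w|lborel. m (\<xi> - ?d n *\<^sub>R w) * G w)) \<longlonglongrightarrow> (2 * pi) ^ DIM('a) * m \<xi>"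
    by (simp only:)
  then show ?thesis
    unfolding eq .
qed

text \<open>At \<xi> = 0 the regularised integrals increase to the integral of the nonnegative
  transform, while their limit is a finite multiple of \<open>m 0\<close>; this is what yields
  integrability. The transform itself is then the majorant that removes the regularisation at
  general \<xi>.\<close>

lemma
  fixes m :: "'a::euclidean_space \<Rightarrow> real"
  assumes m: "integrable lborel m" and even: "\<And>y. m (- y) = m y"
    and cont: "continuous_on UNIV m" and bound: "\<And>y. \<bar>m y\<bar> \<le> B"
    and nonneg: "\<And>x. 0 \<le> cos_transform m x"
  shows integrable_cos_transform_nonneg: "integrable lborel (cos_transform m)"
    and cos_transform_inversion: "cos_transform (cos_transform m) \<xi> = (2 * pi) ^ DIM('a) * m \<xi>"
proof -
  have [measurable]: "m \<in> borel_measurable borel"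
    using m by (auto dest: borel_measurable_integrable)
  note lim = gauss_regularised_limit[OF m even cont bound]
  let ?e = "\<lambda>n y. exp (- (1 / Suc n) * (norm (y::'a))\<^sup>2)"
  have e1: "(\<lambda>n. ?e n y) \<longlonglongrightarrow> 1" for y
  proof -
    have "(\<lambda>n. ?e n y) \<longlonglongrightarrow> exp (- 0 * (norm y)\<^sup>2)"
      by (intro tendsto_intros LIMSEQ_inverse_real_of_nat[unfolded inverse_eq_divide])
    then show ?thesis by simp
  qed
  have "(\<lambda>n. \<integral>\<^sup>+y. ennreal (?e n y * cos_transform m y) \<partial>lborel) \<longlonglongrightarrow> (\<integral>\<^sup>+y. ennreal (cos_transform m y) \<partial>lborel)"
  proof (rule nn_integral_LIMSEQ)
    show "incseq (\<lambda>n y. ennreal (?e n y * cos_transform m y))"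
      using nonneg by (intro incseq_SucI le_funI ennreal_leI mult_right_mono)
        (auto intro!: mult_right_mono simp: frac_le)
    show "(\<lambda>n. ennreal (?e n y * cos_transform m y)) \<longlonglongrightarrow> ennreal (cos_transform m y)" for y
      using tendsto_mult[OF e1[of y] tendsto_const[of "cos_transform m y"]] by (intro tendsto_ennrealI) simp
  qed measurable
  moreover have "(\<integral>\<^sup>+y. ennreal (?e n y * cos_transform m y) \<partial>lborel) = ennreal (LINT y|lborel. ?e n y * cos_transform m y)" for n
  proof (rule nn_integral_eq_integral)
    have "integrable lborel (\<lambda>y. cos_transform m y * ?e n y)"
      by (intro integrable_mult_bounded[OF _ _ cos_transform_bound[OF m]] integrable_gauss) auto
    then show "integrable lborel (\<lambda>y. ?e n y * cos_transform m y)"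
      by (simp add: mult.commute)
  qed (use nonneg in auto)
  moreover have "(\<lambda>n. ennreal (LINT y|lborel. ?e n y * cos_transform m y)) \<longlonglongrightarrow> ennreal ((2 * pi) ^ DIM('a) * m 0)"
    using lim[of 0] by (intro tendsto_ennrealI) simp
  ultimately have "(\<integral>\<^sup>+y. ennreal (cos_transform m y) \<partial>lborel) = ennreal ((2 * pi) ^ DIM('a) * m 0)"
    by (simp add: LIMSEQ_unique)
  then show i: "integrable lborel (cos_transform m)"
    using nonneg by (simp add: integrable_iff_bounded)
  have "(\<lambda>n. LINT y|lborel. ?e n y * cos (\<xi> \<bullet> y) * cos_transform m y)
    \<longlonglongrightarrow> (LINT y|lborel. cos (\<xi> \<bullet> y) * cos_transform m y)"
  proof (rule integral_dominated_convergence[where w="\<lambda>y. \<bar>cos_transform m y\<bar>"])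
    show "AE y in lborel. (\<lambda>n. ?e n y * cos (\<xi> \<bullet> y) * cos_transform m y) \<longlonglongrightarrow> cos (\<xi> \<bullet> y) * cos_transform m y"
      using tendsto_mult[OF tendsto_mult[OF e1 tendsto_const[of "cos (\<xi> \<bullet> _)"]] tendsto_const[of "cos_transform m _"]] by simp
    have "\<bar>?e n y * cos (\<xi> \<bullet> y)\<bar> \<le> 1" for n y
      by (auto simp: abs_mult intro!: mult_le_one)
    from mult_right_mono[OF this]
    show "AE y in lborel. norm (?e n y * cos (\<xi> \<bullet> y) * cos_transform m y) \<le> \<bar>cos_transform m y\<bar>" for n
      by (intro AE_I2) (simp add: abs_mult)
  qed (use i in auto)
  then show "cos_transform (cos_transform m) \<xi> = (2 * pi) ^ DIM('a) * m \<xi>"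
    using lim[of \<xi>] LIMSEQ_unique unfolding cos_transform_def[of "cos_transform m"] by blast
qed


section \<open>Symbols with nonnegative Gaussian-regularised transform\<close>

text \<open>Stands in for complete monotonicity in \<open>\<bar>y\<bar>\<^sup>2\<close>: only the closure properties below are needed.\<close>

definition gauss_positive :: "('a::euclidean_space \<Rightarrow> real) set" where
  "gauss_positive = {m \<in> borel_measurable borel. (\<exists>B. AE y in lborel. \<bar>m y\<bar> \<le> B) \<and>
     (\<forall>a>0. \<forall>x. 0 \<le> cos_transform (\<lambda>y. exp (- a * (norm y)\<^sup>2) * m y) x)}"

lemma integrable_mult_bounded_AE:
  fixes f g :: "'a::euclidean_space \<Rightarrow> real"
  assumes "integrable lborel f" "g \<in> borel_measurable borel" "AE x in lborel. \<bar>g x\<bar> \<le> B"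
  shows "integrable lborel (\<lambda>x. f x * g x)"
proof -
  have "integrable lborel (\<lambda>x. B * f x)"
    using assms by simp
  then show ?thesis
  proof (rule Bochner_Integration.integrable_bound)
    have "\<bar>f x * g x\<bar> \<le> \<bar>B * f x\<bar>" if "\<bar>g x\<bar> \<le> B" for x
      using that mult_left_mono[of "\<bar>g x\<bar>" "\<bar>B\<bar>" "\<bar>f x\<bar>"] by (auto simp: abs_mult mult.commute)
    then show "AE x in lborel. norm (f x * g x) \<le> norm (B * f x)"
      using assms(3) by auto
  qed (use assms in \<open>auto dest: borel_measurable_integrable\<close>)
qed

lemma gauss_positive_integrable:
  fixes m :: "'a::euclidean_space \<Rightarrow> real"
  assumes "m \<in> gauss_positive" "0 < a"
  shows "integrable lborel (\<lambda>y. exp (- a * (norm y)\<^sup>2) * m y)"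
  using assms integrable_mult_bounded_AE[OF integrable_gauss] by (auto simp: gauss_positive_def)

lemma gauss_positive_one: "(\<lambda>_. 1) \<in> gauss_positive"
  by (auto simp: gauss_positive_def cos_transform_gauss[simplified])

text \<open>The class tests every \<open>a > 0\<close>, so an additional Gaussian factor only shifts
  \<open>a\<close> to \<open>a + s\<close>.\<close>

lemma gauss_positive_gauss_mult:
  assumes "m \<in> gauss_positive" "0 \<le> s"
  shows "(\<lambda>y. exp (- s * (norm y)\<^sup>2) * m y) \<in> gauss_positive"
proof -
  obtain B where B: "AE y in lborel. \<bar>m y\<bar> \<le> B" and [measurable]: "m \<in> borel_measurable borel"
    using assms by (auto simp: gauss_positive_def)
  have "AE y in lborel. \<bar>exp (- s * (norm y)\<^sup>2) * m y\<bar> \<le> B"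
    using B
  proof eventually_elim
    case (elim y)
    have "\<bar>exp (- s * (norm y)\<^sup>2) * m y\<bar> \<le> 1 * \<bar>m y\<bar>"
      unfolding abs_mult using assms by (intro mult_right_mono) auto
    with elim show ?case by simp
  qed
  moreover have "0 \<le> cos_transform (\<lambda>y. exp (- a * (norm y)\<^sup>2) * (exp (- s * (norm y)\<^sup>2) * m y)) x"
    if "a > 0" for a x
  proof -
    have "exp (- a * (norm y)\<^sup>2) * (exp (- s * (norm y)\<^sup>2) * m y) = exp (- (a + s) * (norm y)\<^sup>2) * m y" for y
      by (simp add: exp_add[symmetric] algebra_simps)
    moreover have "0 \<le> cos_transform (\<lambda>y. exp (- (a + s) * (norm y)\<^sup>2) * m y) x"
      using assms that by (auto simp: gauss_positive_def simp del: minus_add_distrib)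
    ultimately show ?thesis by (simp only:)
  qed
  ultimately show ?thesis
    by (auto simp: gauss_positive_def)
qed

lemma gauss_positive_scale:
  assumes "m \<in> gauss_positive" "0 \<le> c"
  shows "(\<lambda>y. c * m y) \<in> gauss_positive"
proof -
  obtain B where B: "AE y in lborel. \<bar>m y\<bar> \<le> B" and [measurable]: "m \<in> borel_measurable borel"
    using assms by (auto simp: gauss_positive_def)
  have "AE y in lborel. \<bar>c * m y\<bar> \<le> c * B"
    using B by eventually_elim (use assms in \<open>auto simp: abs_mult intro!: mult_left_mono\<close>)
  moreover have "cos_transform (\<lambda>y. exp (- a * (norm y)\<^sup>2) * (c * m y)) x =
      c * cos_transform (\<lambda>y. exp (- a * (norm y)\<^sup>2) * m y) x" for a x
    unfolding cos_transform_def integral_mult_right_zero[symmetric] by (simp add: mult_ac)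
  ultimately show ?thesis
    using assms unfolding gauss_positive_def by auto
qed

lemma gauss_positive_add:
  assumes "m \<in> gauss_positive" "m' \<in> gauss_positive"
  shows "(\<lambda>y. m y + m' y) \<in> gauss_positive"
proof -
  obtain B B' where B: "AE y in lborel. \<bar>m y\<bar> \<le> B" "AE y in lborel. \<bar>m' y\<bar> \<le> B'"
    and [measurable]: "m \<in> borel_measurable borel" "m' \<in> borel_measurable borel"
    using assms by (auto simp: gauss_positive_def)
  have "AE y in lborel. \<bar>m y + m' y\<bar> \<le> B + B'"
    using B by eventually_elim auto
  moreover have "cos_transform (\<lambda>y. exp (- a * (norm y)\<^sup>2) * (m y + m' y)) x =
      cos_transform (\<lambda>y. exp (- a * (norm y)\<^sup>2) * m y) x + cos_transform (\<lambda>y. exp (- a * (norm y)\<^sup>2) * m' y) x"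
    if "0 < a" for a x
    unfolding cos_transform_def
    using integrable_cos_mult(1)[OF gauss_positive_integrable[OF assms(1) that], of x]
      integrable_cos_mult(1)[OF gauss_positive_integrable[OF assms(2) that], of x]
    by (simp add: distrib_left)
  ultimately show ?thesis
    using assms unfolding gauss_positive_def by auto
qed

lemma gauss_positive_sum:
  assumes "\<And>i. i \<in> I \<Longrightarrow> m i \<in> gauss_positive"
  shows "(\<lambda>y. \<Sum>i\<in>I. m i y) \<in> gauss_positive"
  using assms
proof (induction I rule: infinite_finite_induct)
  case (insert i I)
  then show ?case
    by (simp add: gauss_positive_add)
qed (use gauss_positive_scale[OF gauss_positive_one, of 0] in simp_all)

text \<open>The test Gaussian in the definition provides the integrable majorant, so a uniform bound
  on the sequence suffices for dominated convergence.\<close>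

lemma gauss_positive_limit:
  fixes m :: "'a::euclidean_space \<Rightarrow> real"
  assumes M: "\<And>n::nat. M n \<in> gauss_positive"
    and bound: "\<And>n. AE y in lborel. \<bar>M n y\<bar> \<le> B"
    and lim: "AE y in lborel. (\<lambda>n. M n y) \<longlonglongrightarrow> m y"
    and [measurable]: "m \<in> borel_measurable borel"
  shows "m \<in> gauss_positive"
proof -
  have [measurable]: "\<And>n. M n \<in> borel_measurable borel"
    using M by (auto simp: gauss_positive_def)
  have "AE y in lborel. \<forall>n. \<bar>M n y\<bar> \<le> B"
    using bound by (simp add: AE_all_countable)
  with lim have "AE y in lborel. \<bar>m y\<bar> \<le> B"
    by eventually_elim (auto intro!: LIMSEQ_le_const2 tendsto_rabs)
  moreover have "0 \<le> cos_transform (\<lambda>y. exp (- a * (norm y)\<^sup>2) * m y) x" if a: "0 < a" for a x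
  proof (rule LIMSEQ_le_const)
    show "(\<lambda>n. cos_transform (\<lambda>y. exp (- a * (norm y)\<^sup>2) * M n y) x) \<longlonglongrightarrow>
        cos_transform (\<lambda>y. exp (- a * (norm y)\<^sup>2) * m y) x"
      unfolding cos_transform_def
    proof (rule integral_dominated_convergence[where w="\<lambda>y. B * exp (- a * (norm y)\<^sup>2)"])
      show "AE y in lborel. (\<lambda>n. cos (x \<bullet> y) * (exp (- a * (norm y)\<^sup>2) * M n y)) \<longlonglongrightarrow> cos (x \<bullet> y) * (exp (- a * (norm y)\<^sup>2) * m y)"
        using lim by eventually_elim (intro tendsto_mult tendsto_const)
      show "AE y in lborel. norm (cos (x \<bullet> y) * (exp (- a * (norm y)\<^sup>2) * M n y)) \<le> B * exp (- a * (norm y)\<^sup>2)" for n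
        using bound[of n]
      proof eventually_elim
        case (elim y)
        have "\<bar>cos (x \<bullet> y)\<bar> * (exp (- a * (norm y)\<^sup>2) * \<bar>M n y\<bar>) \<le> 1 * (exp (- a * (norm y)\<^sup>2) * B)"
          using elim by (intro mult_mono mult_left_mono) auto
        then show ?case by (simp add: abs_mult mult.commute)
      qed
    qed (use integrable_gauss[OF a] in auto)
    show "\<exists>N. \<forall>n\<ge>N. 0 \<le> cos_transform (\<lambda>y. exp (- a * (norm y)\<^sup>2) * M n y) x"
      using M a by (auto simp: gauss_positive_def)
  qed
  ultimately show ?thesis
    by (auto simp: gauss_positive_def)
qed

section \<open>The binomial series and Bernstein's approximation\<close>

lemma sum_le_sums:
  fixes f :: "nat \<Rightarrow> real"
  assumes "f sums s" "\<And>k. 0 \<le> f k"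
  shows "(\<Sum>k<n. f k) \<le> s"
  using sum_le_suminf[OF sums_summable[OF assms(1)], of "{..<n}"] assms sums_unique[OF assms(1)] by simp

text \<open>Each step of the recursion multiplies by (n + 1 - \<gamma>) / (n + 2), positive because
  \<gamma> < 1; the sign is therefore that of the first term, - \<gamma>.\<close>

lemma gbinomial_alternating_nonpos:
  fixes \<gamma> :: real
  assumes "0 < \<gamma>" "\<gamma> < 1"
  shows "(\<gamma> gchoose Suc n) * (- 1) ^ Suc n \<le> 0"
proof (induction n)
  case (Suc n)
  have "(\<gamma> gchoose Suc (Suc n)) * real (Suc (Suc n)) = (\<gamma> gchoose Suc n) * (\<gamma> - real (Suc n))"
    using gbinomial_mult_1'[of \<gamma> "Suc n"] by (simp add: algebra_simps)
  then have "(\<gamma> gchoose Suc (Suc n)) = (\<gamma> gchoose Suc n) * (\<gamma> - real (Suc n)) / real (Suc (Suc n))"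
    by (simp add: field_simps)
  moreover have "a * (g - s) / d * (- 1 * q) = a * q * ((s - g) / d)" for a g s d q :: real
    by (simp add: divide_inverse algebra_simps)
  ultimately have "(\<gamma> gchoose Suc (Suc n)) * (- 1) ^ Suc (Suc n) =
      ((\<gamma> gchoose Suc n) * (- 1) ^ Suc n) * ((real (Suc n) - \<gamma>) / real (Suc (Suc n)))"
    by (simp only: power_Suc[of _ "Suc n"])
  also have "\<dots> \<le> 0"
    using assms by (intro mult_nonpos_nonneg Suc.IH divide_nonneg_nonneg) auto
  finally show ?case .
qed (use assms in simp)

lemma one_minus_powr_expansion:
  fixes \<gamma> :: real
  assumes "0 < \<gamma>" "\<gamma> < 1"
  obtains c :: "nat \<Rightarrow> real" where "\<And>k. 0 \<le> c k"
    "\<And>w. 0 \<le> w \<Longrightarrow> w < 1 \<Longrightarrow> (\<lambda>k. c k * w ^ k) sums (1 - (1 - w) powr \<gamma>)"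
proof
  let ?c = "\<lambda>k. if k = 0 then 0 else - ((\<gamma> gchoose k) * (- 1) ^ k)"
  show "0 \<le> ?c k" for k
    using gbinomial_alternating_nonpos[OF assms, of "k - 1"] by (cases k) auto
  show "(\<lambda>k. ?c k * w ^ k) sums (1 - (1 - w) powr \<gamma>)" if "0 \<le> w" "w < 1" for w
  proof -
    have "(\<lambda>k. (\<gamma> gchoose k) * (- w) ^ k) sums (1 + - w) powr \<gamma>"
      using that by (intro gen_binomial_real) auto
    from sums_diff[OF sums_If_finite_set[of "{0}" "\<lambda>_. 1"] this]
    have "(\<lambda>k. (if k = 0 then 1 else 0) - (\<gamma> gchoose k) * (- w) ^ k) sums (1 - (1 - w) powr \<gamma>)"
      by (simp cong: if_cong)
    moreover have "(if k = 0 then 1 else 0) - (\<gamma> gchoose k) * (- w) ^ k = ?c k * w ^ k" for k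
      by (simp add: power_minus[of w])
    ultimately show ?thesis by simp
  qed
qed

text \<open>With \<open>Q\<close> = 1 - (1 - w)^\<gamma> the function is exp(- L) exp(L Q). Both the
  series of \<open>Q\<close> in powers of the Gaussian \<open>w\<close> and the exponential series
  have nonnegative coefficients, so only closure under sums, scaling, Gaussian factors and bounded
  limits enters.\<close>

lemma gauss_positive_exp_scaled:
  fixes \<gamma> \<epsilon> L :: real
  assumes \<gamma>: "0 < \<gamma>" "\<gamma> < 1" and \<epsilon>: "0 < \<epsilon>" and L: "0 \<le> L"
  shows "(\<lambda>y::'a::euclidean_space. exp (- L * (1 - exp (- \<epsilon> * (norm y)\<^sup>2)) powr \<gamma>)) \<in> gauss_positive"
proof -
  obtain c :: "nat \<Rightarrow> real" where c: "\<And>k. 0 \<le> c k"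
    "\<And>w. 0 \<le> w \<Longrightarrow> w < 1 \<Longrightarrow> (\<lambda>k. c k * w ^ k) sums (1 - (1 - w) powr \<gamma>)"
    using one_minus_powr_expansion[OF \<gamma>] by blast
  define w where "w = (\<lambda>y::'a. exp (- \<epsilon> * (norm y)\<^sup>2))"
  define Q where "Q = (\<lambda>y. 1 - (1 - w y) powr \<gamma>)"
  have w01: "0 \<le> w y" "w y \<le> 1" for y
    using \<epsilon> by (auto simp: w_def)
  have Q01: "0 \<le> Q y" "Q y \<le> 1" for y
    using w01[of y] \<gamma> powr_le1[of \<gamma> "1 - w y"] by (auto simp: Q_def)
  have [measurable]: "w \<in> borel_measurable borel" "Q \<in> borel_measurable borel"
    unfolding Q_def w_def by measurable
  \<comment> \<open>At the origin w = 1 lies on the boundary of the disc of convergence, outside the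
    range of the series expansion; hence the almost-everywhere statements.\<close>
  have ne: "AE y::'a in lborel. y \<noteq> 0"
    by (rule AE_lborel_singleton)
  have w1: "w y < 1" if "y \<noteq> 0" for y
    using that \<epsilon> by (simp add: w_def)
  \<comment> \<open>Closure of the class under general products is not established. Multiplication
    by \<open>Q\<close> preserves it because each power of \<open>w\<close> is a Gaussian
    factor.\<close>
  have Qmult: "(\<lambda>y. Q y * m y) \<in> gauss_positive" if m: "m \<in> gauss_positive" for m
  proof -
    obtain B where B: "AE y in lborel. \<bar>m y\<bar> \<le> B" and [measurable]: "m \<in> borel_measurable borel"
      using m by (auto simp: gauss_positive_def)
    have wk: "(\<lambda>y. w y ^ k * m y) \<in> gauss_positive" for k
    proof -
      have "w y ^ k = exp (- (real k * \<epsilon>) * (norm y)\<^sup>2)" for y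
        unfolding w_def by (simp add: exp_of_nat_mult[symmetric] mult.assoc)
      then show ?thesis
        using gauss_positive_gauss_mult[OF m, of "real k * \<epsilon>"] \<epsilon> by (simp only:) simp
    qed
    show ?thesis
    proof (rule gauss_positive_limit)
      show "(\<lambda>y. \<Sum>k<n. c k * (w y ^ k * m y)) \<in> gauss_positive" for n
        by (intro gauss_positive_sum gauss_positive_scale wk c)
      show "AE y in lborel. \<bar>\<Sum>k<n. c k * (w y ^ k * m y)\<bar> \<le> B" for n
        using B ne
      proof eventually_elim
        case (elim y)
        have "(\<Sum>k<n. c k * w y ^ k) \<le> Q y"
          unfolding Q_def using c w01 w1[OF elim(2)] by (intro sum_le_sums c(2)) auto
        then have "(\<Sum>k<n. c k * w y ^ k) * \<bar>m y\<bar> \<le> 1 * B"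
          using Q01[of y] elim by (intro mult_mono) auto
        moreover have "0 \<le> (\<Sum>k<n. c k * w y ^ k)"
          using c w01 by (intro sum_nonneg mult_nonneg_nonneg) auto
        ultimately show ?case
          by (simp add: mult.assoc[symmetric] sum_distrib_right[symmetric] abs_mult)
      qed
      show "AE y in lborel. (\<lambda>n. \<Sum>k<n. c k * (w y ^ k * m y)) \<longlonglongrightarrow> Q y * m y"
        using ne
      proof eventually_elim
        case (elim y)
        have "(\<lambda>k. c k * w y ^ k * m y) sums (Q y * m y)"
          unfolding Q_def using c(2) w01 w1[OF elim] by (intro sums_mult2) auto
        then show ?case by (simp add: sums_def mult.assoc)
      qed
    qed measurable
  qed
  have Qpow: "(\<lambda>y. Q y ^ k) \<in> gauss_positive" for k
    by (induction k) (use gauss_positive_one Qmult in auto)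
  have "(\<lambda>y. exp (L * Q y)) \<in> gauss_positive"
  proof (rule gauss_positive_limit)
    show "(\<lambda>y. \<Sum>k<n. inverse (fact k) * L ^ k * Q y ^ k) \<in> gauss_positive" for n
      using L by (intro gauss_positive_sum gauss_positive_scale Qpow) auto
    have s: "(\<lambda>k. inverse (fact k) * L ^ k * Q y ^ k) sums exp (L * Q y)" for y
      using exp_converges[of "L * Q y"] by (simp add: power_mult_distrib mult.assoc)
    show "AE y in lborel. (\<lambda>n. \<Sum>k<n. inverse (fact k) * L ^ k * Q y ^ k) \<longlonglongrightarrow> exp (L * Q y)"
      using s by (simp add: sums_def)
    show "AE y in lborel. \<bar>\<Sum>k<n. inverse (fact k) * L ^ k * Q y ^ k\<bar> \<le> exp L" for n
    proof (rule AE_I2)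
      fix y
      have "(\<Sum>k<n. inverse (fact k) * L ^ k * Q y ^ k) \<le> exp (L * Q y)"
        using L Q01 by (intro sum_le_sums s) auto
      also have "\<dots> \<le> exp L"
        using L Q01[of y] by (simp add: mult_left_le)
      finally show "\<bar>\<Sum>k<n. inverse (fact k) * L ^ k * Q y ^ k\<bar> \<le> exp L"
        using L Q01 by (simp add: abs_of_nonneg sum_nonneg)
    qed
  qed measurable
  from gauss_positive_scale[OF this, of "exp (- L)"]
  have "(\<lambda>y. exp (- L) * exp (L * Q y)) \<in> gauss_positive"
    by simp
  also have "(\<lambda>y. exp (- L) * exp (L * Q y)) = (\<lambda>y. exp (- L * (1 - w y) powr \<gamma>))"
    by (simp add: exp_add[symmetric] Q_def algebra_simps)
  finally show ?thesis
    by (simp add: w_def)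
qed

text \<open>The preceding lemma with \<epsilon> = 1 / (n + 1) and L = t \<epsilon>^(- \<gamma>): the
  exponent is then - t ((1 - exp(- \<epsilon> r)) / \<epsilon>)^\<gamma> with r = |y|^2, and the
  quotient tends to r.\<close>

lemma gauss_positive_exp_powr:
  fixes t \<gamma> :: real
  assumes \<gamma>: "0 < \<gamma>" "\<gamma> < 1" and t: "0 \<le> t"
  shows "(\<lambda>y::'a::euclidean_space. exp (- t * ((norm y)\<^sup>2) powr \<gamma>)) \<in> gauss_positive"
proof (rule gauss_positive_limit)
  let ?\<epsilon> = "\<lambda>n. 1 / real (Suc n)"
  show "(\<lambda>y::'a. exp (- (t * ?\<epsilon> n powr (- \<gamma>)) * (1 - exp (- ?\<epsilon> n * (norm y)\<^sup>2)) powr \<gamma>)) \<in> gauss_positive" for n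
    using t by (intro gauss_positive_exp_scaled \<gamma>) auto
  show "AE y::'a in lborel. \<bar>exp (- (t * ?\<epsilon> n powr (- \<gamma>)) * (1 - exp (- ?\<epsilon> n * (norm y)\<^sup>2)) powr \<gamma>)\<bar> \<le> 1" for n
    using t by (intro AE_I2) simp
  show "AE y::'a in lborel. (\<lambda>n. exp (- (t * ?\<epsilon> n powr (- \<gamma>)) * (1 - exp (- ?\<epsilon> n * (norm y)\<^sup>2)) powr \<gamma>)) \<longlonglongrightarrow> exp (- t * ((norm y)\<^sup>2) powr \<gamma>)"
  proof (rule AE_I2)
    fix y :: 'a
    define r where "r = (norm y)\<^sup>2"
    have r: "r \<ge> 0" by (simp add: r_def)
    \<comment> \<open>The quotient is minus the difference quotient of exp(- x r) at x = 0.\<close>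
    have "((\<lambda>x. exp (- x * r)) has_real_derivative - r) (at 0)"
      by (auto intro!: derivative_eq_intros)
    then have "((\<lambda>x. (exp (- x * r) - 1) / x) \<longlongrightarrow> - r) (at 0)"
      by (simp add: has_field_derivative_iff)
    then have "((\<lambda>x. - ((exp (- x * r) - 1) / x)) \<longlongrightarrow> r) (at 0)"
      using tendsto_minus_cancel_left by fastforce
    moreover have "filterlim ?\<epsilon> (at 0) sequentially"
      using LIMSEQ_inverse_real_of_nat by (auto simp: filterlim_at inverse_eq_divide)
    ultimately have "(\<lambda>n. - ((exp (- ?\<epsilon> n * r) - 1) / ?\<epsilon> n)) \<longlonglongrightarrow> r"
      by (rule filterlim_compose)
    then have "(\<lambda>n. (- ((exp (- ?\<epsilon> n * r) - 1) / ?\<epsilon> n)) powr \<gamma>) \<longlonglongrightarrow> r powr \<gamma>"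
    proof (rule tendsto_powr2)
      have "exp (- ?\<epsilon> n * r) \<le> 1" for n
        using r by simp
      then show "\<forall>\<^sub>F n in sequentially. 0 \<le> - ((exp (- ?\<epsilon> n * r) - 1) / ?\<epsilon> n)"
        by (intro always_eventually allI) (simp only: neg_0_le_iff_le, intro divide_nonpos_nonneg, auto)
    qed (use \<gamma> in auto)
    moreover have "(- ((exp (- ?\<epsilon> n * r) - 1) / ?\<epsilon> n)) powr \<gamma> = ?\<epsilon> n powr (- \<gamma>) * (1 - exp (- ?\<epsilon> n * r)) powr \<gamma>" for n
    proof -
      have "(- ((z - 1) / e)) powr \<gamma> = e powr (- \<gamma>) * (1 - z) powr \<gamma>" if "0 < e" "z \<le> 1" for e z :: real
      proof -
        have "- ((z - 1) / e) = (1 - z) / e"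
          by (simp add: minus_divide_left)
        moreover have "((1 - z) / e) powr \<gamma> = (1 - z) powr \<gamma> / e powr \<gamma>"
          by (rule powr_divide)
        ultimately show ?thesis
          by (simp only: powr_minus_divide) simp
      qed
      moreover have "0 < ?\<epsilon> n" "exp (- ?\<epsilon> n * r) \<le> 1"
        using r by simp_all
      ultimately show ?thesis
        by blast
    qed
    ultimately have "(\<lambda>n. ?\<epsilon> n powr (- \<gamma>) * (1 - exp (- ?\<epsilon> n * r)) powr \<gamma>) \<longlonglongrightarrow> r powr \<gamma>"
      by simp
    then have "(\<lambda>n. exp (- (t * (?\<epsilon> n powr (- \<gamma>) * (1 - exp (- ?\<epsilon> n * r)) powr \<gamma>)))) \<longlonglongrightarrow> exp (- (t * r powr \<gamma>))"
      by (intro tendsto_intros)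
    then show "(\<lambda>n. exp (- (t * ?\<epsilon> n powr (- \<gamma>)) * (1 - exp (- ?\<epsilon> n * (norm y)\<^sup>2)) powr \<gamma>)) \<longlonglongrightarrow> exp (- t * ((norm y)\<^sup>2) powr \<gamma>)"
      by (simp add: r_def mult.assoc)
  qed
qed measurable

section \<open>The heat kernel\<close>

definition symbol_exp :: "real \<Rightarrow> real \<Rightarrow> 'a::euclidean_space \<Rightarrow> real" where
  "symbol_exp \<alpha> t \<xi> = exp (- t * (norm \<xi>)\<^sup>2) * exp (- t * norm \<xi> powr \<alpha>)"

text \<open>The inverse Fourier transform of the symbol, the convenient form for mass and semigroup
  law; \<open>heat_kernel_eq\<close> identifies it with the convolution of the statement.\<close>

definition mixed_kernel :: "real \<Rightarrow> real \<Rightarrow> 'a::euclidean_space \<Rightarrow> real" where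
  "mixed_kernel \<alpha> t x = cos_transform (symbol_exp \<alpha> t) x / (2 * pi) ^ DIM('a)"

lemma symbol_exp_measurable[measurable]:
  "(\<lambda>(t, \<xi>). symbol_exp \<alpha> t (\<xi>::'a::euclidean_space)) \<in> borel_measurable (borel \<Otimes>\<^sub>M borel)"
  unfolding symbol_exp_def by measurable

lemma symbol_exp_measurable'[measurable]:
  "symbol_exp \<alpha> t \<in> borel_measurable (borel :: 'a::euclidean_space measure)"
  unfolding symbol_exp_def[abs_def] by measurable

lemma symbol_exp_even: "symbol_exp \<alpha> t (- \<xi>) = symbol_exp \<alpha> t \<xi>"
  by (simp add: symbol_exp_def)

lemma symbol_exp_le_1:
  assumes "0 < t"
  shows "\<bar>symbol_exp \<alpha> t \<xi>\<bar> \<le> 1"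
  using assms by (auto simp: symbol_exp_def abs_mult intro!: mult_le_one)

lemma symbol_exp_mult: "symbol_exp \<alpha> s \<xi> * symbol_exp \<alpha> t \<xi> = symbol_exp \<alpha> (s + t) \<xi>"
  by (simp add: symbol_exp_def exp_add[symmetric] algebra_simps)

lemma symbol_exp_antimono: "s \<le> t \<Longrightarrow> symbol_exp \<alpha> t \<xi> \<le> symbol_exp \<alpha> s \<xi>"
  unfolding symbol_exp_def by (intro mult_mono) (auto intro!: mult_right_mono)

lemma integrable_symbol_exp:
  assumes "0 < t"
  shows "integrable lborel (symbol_exp \<alpha> t :: 'a::euclidean_space \<Rightarrow> real)"
  unfolding symbol_exp_def
  by (rule integrable_mult_bounded_AE[OF integrable_gauss, where B=1]) (use assms in auto)

lemma continuous_symbol_exp: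
  assumes "0 < \<alpha>"
  shows "continuous_on UNIV (symbol_exp \<alpha> t :: 'a::euclidean_space \<Rightarrow> real)"
  unfolding symbol_exp_def using assms by (intro continuous_intros continuous_on_powr') auto

text \<open>The factor coming from the Laplacian is itself a test Gaussian of
  \<open>gauss_positive\<close>, with \<open>a = t\<close>; the fractional factor lies in that class
  with \<gamma> = \<alpha> / 2.\<close>

lemma cos_transform_symbol_exp_nonneg:
  assumes \<alpha>: "0 < \<alpha>" "\<alpha> < 2" and t: "0 < t"
  shows "0 \<le> cos_transform (symbol_exp \<alpha> t) (x::'a::euclidean_space)"
proof -
  have "((norm \<xi>)\<^sup>2) powr (\<alpha> / 2) = norm \<xi> powr \<alpha>" for \<xi> :: 'a
    by (cases "\<xi> = 0") (simp_all add: powr_powr flip: powr_numeral)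
  then show ?thesis
    using gauss_positive_exp_powr[of "\<alpha> / 2" t, where 'a='a] \<alpha> t
    by (simp add: gauss_positive_def symbol_exp_def[abs_def])
qed

lemma mixed_kernel_measurable[measurable]:
  "(\<lambda>(t, x). mixed_kernel \<alpha> t (x::'a::euclidean_space)) \<in> borel_measurable (borel \<Otimes>\<^sub>M borel)"
  unfolding mixed_kernel_def cos_transform_def by measurable

lemma mixed_kernel_measurable'[measurable]:
  assumes [measurable]: "f \<in> borel_measurable M" "g \<in> borel_measurable M"
  shows "(\<lambda>z. mixed_kernel \<alpha> (f z) (g z::'a::euclidean_space)) \<in> borel_measurable M"
  using measurable_compose[OF measurable_Pair[OF assms] mixed_kernel_measurable] by simp

lemma mixed_kernel_even: "mixed_kernel \<alpha> t (- x) = mixed_kernel \<alpha> t x"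
  by (simp add: mixed_kernel_def cos_transform_even)

text \<open>Nonnegativity of the transform is what makes the inversion theorem applicable. The mass
  is the value 1 of the symbol at the origin.\<close>

lemma
  assumes \<alpha>: "0 < \<alpha>" "\<alpha> < 2" and t: "0 < t"
  shows mixed_kernel_nonneg: "0 \<le> mixed_kernel \<alpha> t (x::'a::euclidean_space)"
    and integrable_mixed_kernel: "integrable lborel (mixed_kernel \<alpha> t :: 'a \<Rightarrow> real)"
    and cos_transform_mixed_kernel: "cos_transform (mixed_kernel \<alpha> t) x = symbol_exp \<alpha> t x"
    and integral_mixed_kernel: "(LINT y|lborel. mixed_kernel \<alpha> t (y::'a)) = 1"
proof -
  note m = integrable_symbol_exp[OF t] symbol_exp_even continuous_symbol_exp[OF \<alpha>(1)] symbol_exp_le_1[OF t]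
    cos_transform_symbol_exp_nonneg[OF \<alpha> t]
  show "0 \<le> mixed_kernel \<alpha> t x"
    unfolding mixed_kernel_def by (intro divide_nonneg_pos m(5)) simp
  show "integrable lborel (mixed_kernel \<alpha> t :: 'a \<Rightarrow> real)"
    unfolding mixed_kernel_def[abs_def] by (intro integrable_divide integrable_cos_transform_nonneg[OF m])
  have "cos_transform (mixed_kernel \<alpha> t) x = cos_transform (cos_transform (symbol_exp \<alpha> t)) x / (2 * pi) ^ DIM('a)" for x :: 'a
    by (simp add: cos_transform_def[of "mixed_kernel \<alpha> t"] cos_transform_def[of "cos_transform _"] mixed_kernel_def)
  then show *: "cos_transform (mixed_kernel \<alpha> t) x = symbol_exp \<alpha> t x" for x :: 'a
    by (simp add: cos_transform_inversion[OF m])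
  show "(LINT y|lborel. mixed_kernel \<alpha> t (y::'a)) = 1"
    using *[of 0] by (simp add: cos_transform_def symbol_exp_def)
qed

lemma nn_integral_mixed_kernel:
  assumes "0 < \<alpha>" "\<alpha> < 2" and "0 < t"
  shows "(\<integral>\<^sup>+y. ennreal (mixed_kernel \<alpha> t (y::'a::euclidean_space)) \<partial>lborel) = 1"
  using assms by (simp add: nn_integral_eq_integral integrable_mixed_kernel mixed_kernel_nonneg integral_mixed_kernel)

text \<open>The convolution theorem multiplies the symbols, and their exponents are linear in
  time.\<close>

lemma mixed_kernel_semigroup:
  assumes \<alpha>: "0 < \<alpha>" "\<alpha> < 2" and s: "0 < s" and t: "0 < t"
  shows "(LINT y|lborel. mixed_kernel \<alpha> s (x - y) * mixed_kernel \<alpha> t y) = mixed_kernel \<alpha> (s + t) (x::'a::euclidean_space)"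
proof -
  have "(LINT y|lborel. mixed_kernel \<alpha> s (x - y) * mixed_kernel \<alpha> t y) =
      (LINT y|lborel. mixed_kernel \<alpha> t y * cos_transform (symbol_exp \<alpha> s) (x - y)) / (2 * pi) ^ DIM('a)"
    by (simp add: mixed_kernel_def[of _ s] mult.commute)
  also have "\<dots> = cos_transform (\<lambda>\<xi>. symbol_exp \<alpha> t \<xi> * symbol_exp \<alpha> s \<xi>) x / (2 * pi) ^ DIM('a)"
    by (subst cos_transform_convolution)
      (auto intro!: integrable_mixed_kernel integrable_symbol_exp assms simp: mixed_kernel_even cos_transform_mixed_kernel assms)
  finally show ?thesis
    by (simp add: symbol_exp_mult add.commute mixed_kernel_def[of _ "s + t"])
qed

text \<open>Scheffe's lemma: all kernels are nonnegative with the same mass, so pointwise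
  convergence already gives convergence in L^1.\<close>

lemma mixed_kernel_L1_continuous:
  assumes \<alpha>: "0 < \<alpha>" "\<alpha> < 2" and t: "0 < t" and T: "T \<longlonglongrightarrow> t"
  shows "(\<lambda>n. \<integral>\<^sup>+y. ennreal \<bar>mixed_kernel \<alpha> (T n) y - mixed_kernel \<alpha> t (y::'a::euclidean_space)\<bar> \<partial>lborel) \<longlonglongrightarrow> 0"
proof -
  \<comment> \<open>Cutting off below t / 2 makes every time positive and lets the symbol at t / 2
    dominate all the others; eventually nothing has changed.\<close>
  define T' where "T' = (\<lambda>n. max (T n) (t / 2))"
  have T': "T' \<longlonglongrightarrow> t" "\<And>n. t / 2 \<le> T' n" "\<And>n. 0 < T' n"
    using tendsto_max[OF T tendsto_const[of "t / 2"]] t by (auto simp: T'_def max_def)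
  have "(\<lambda>n. \<integral>\<^sup>+y. ennreal (norm (mixed_kernel \<alpha> (T' n) y - mixed_kernel \<alpha> t (y::'a))) \<partial>lborel) \<longlonglongrightarrow> 0"
  proof (rule Scheffe_lemma1)
    show "AE x::'a in lborel. (\<lambda>n. mixed_kernel \<alpha> (T' n) x) \<longlonglongrightarrow> mixed_kernel \<alpha> t x"
    proof (rule AE_I2)
      fix x :: 'a
      have "(\<lambda>n. LINT y|lborel. cos (x \<bullet> y) * symbol_exp \<alpha> (T' n) y) \<longlonglongrightarrow> (LINT y|lborel. cos (x \<bullet> y) * symbol_exp \<alpha> t y)"
      proof (rule integral_dominated_convergence[where w="symbol_exp \<alpha> (t / 2)"])
        show "AE y in lborel. (\<lambda>n. cos (x \<bullet> y) * symbol_exp \<alpha> (T' n) y) \<longlonglongrightarrow> cos (x \<bullet> y) * symbol_exp \<alpha> t y"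
          unfolding symbol_exp_def using T'(1) by (intro AE_I2 tendsto_intros)
        have "\<bar>cos (x \<bullet> y)\<bar> * \<bar>symbol_exp \<alpha> (T' n) y\<bar> \<le> 1 * symbol_exp \<alpha> (t / 2) y" for n y
          using symbol_exp_antimono[OF T'(2)] by (intro mult_mono) (auto simp: symbol_exp_def)
        then show "AE y in lborel. norm (cos (x \<bullet> y) * symbol_exp \<alpha> (T' n) y) \<le> symbol_exp \<alpha> (t / 2) y" for n
          by (simp add: abs_mult)
      qed (use t in \<open>auto intro!: integrable_symbol_exp\<close>)
      then show "(\<lambda>n. mixed_kernel \<alpha> (T' n) x) \<longlonglongrightarrow> mixed_kernel \<alpha> t x"
        unfolding mixed_kernel_def cos_transform_def by (intro tendsto_divide tendsto_const) auto
    qed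
    show "limsup (\<lambda>n. \<integral>\<^sup>+x. ennreal (norm (mixed_kernel \<alpha> (T' n) (x::'a))) \<partial>lborel) \<le> (\<integral>\<^sup>+x. ennreal (norm (mixed_kernel \<alpha> t (x::'a))) \<partial>lborel)"
      using \<alpha> t T'(3) by (simp add: mixed_kernel_nonneg nn_integral_mixed_kernel Limsup_const)
  qed (use \<alpha> t T'(3) integrable_mixed_kernel in auto)
  moreover have "\<forall>\<^sub>F n in sequentially. T' n = T n"
    using order_tendstoD(1)[OF T, of "t / 2"] t by (auto simp: T'_def elim!: eventually_mono)
  ultimately show ?thesis
    by (elim Lim_transform_eventually) (auto elim!: eventually_mono)
qed

section \<open>Identification with the kernels of the statement\<close>

lemma stable_kernel_eq:
  fixes x :: "real ^ 'n"
  assumes "0 < \<alpha>" "0 < t"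
  shows "stable_kernel \<alpha> t x = cos_transform (\<lambda>\<xi>. exp (- t * norm \<xi> powr \<alpha>)) x / (2 * pi) ^ CARD('n)"
proof -
  let ?F = "\<lambda>\<xi>. exp (\<i> * complex_of_real (x \<bullet> \<xi>) - complex_of_real (t * norm \<xi> powr \<alpha>))"
  have F: "?F \<in> borel_measurable borel"
    by measurable
  have "integrable lborel ?F"
    by (rule Bochner_Integration.integrable_bound[OF integrable_exp_norm_powr[OF assms(2,1)]]) (use F in auto)
  then have "Re (LINT \<xi>|lebesgue. ?F \<xi>) = (LINT \<xi>|lborel. Re (?F \<xi>))"
    using F by (simp add: integral_completion)
  also have "\<dots> = (LINT \<xi>|lborel. cos (x \<bullet> \<xi>) * exp (- t * norm \<xi> powr \<alpha>))"
    by (simp add: Re_exp mult.commute)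
  finally show ?thesis
    by (simp add: stable_kernel_def cos_transform_def powr_minus_divide powr_realpow)
qed

text \<open>The convolution theorem applied to the Gauss kernel, whose transform is exp(- t
  |\<xi>|^2), and to the symbol of the stable kernel. A reflection first exchanges the two factors
  of the convolution.\<close>

lemma heat_kernel_eq:
  fixes x :: "real ^ 'n"
  assumes \<alpha>: "0 < \<alpha>" and t: "0 < t"
  shows "heat_kernel \<alpha> t x = mixed_kernel \<alpha> t x"
proof -
  let ?m = "\<lambda>\<xi>::real^'n. exp (- t * norm \<xi> powr \<alpha>)"
  let ?g = "gauss_kernel t :: real^'n \<Rightarrow> real"
  have m: "integrable lborel ?m"
    by (rule integrable_exp_norm_powr[OF t \<alpha>])
  have g_eq: "?g = (\<lambda>x. (4 * pi * t) powr (- (real CARD('n) / 2)) * exp (- (1 / (4 * t)) * (norm x)\<^sup>2))"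
    by (simp add: gauss_kernel_def fun_eq_iff)
  have g: "integrable lborel ?g"
    unfolding g_eq using t by (intro integrable_mult_right integrable_gauss) auto
  have [measurable]: "?g \<in> borel_measurable borel"
    using g by (auto dest: borel_measurable_integrable)
  have gt: "cos_transform ?g \<xi> = exp (- t * (norm \<xi>)\<^sup>2)" for \<xi>
  proof -
    have "cos_transform ?g \<xi> = (4 * pi * t) powr (- (real CARD('n) / 2)) * cos_transform (\<lambda>x. exp (- (1 / (4 * t)) * (norm x)\<^sup>2)) \<xi>"
      unfolding cos_transform_def g_eq integral_mult_right_zero[symmetric] by (simp add: mult_ac)
    also have "\<dots> = exp (- t * (norm \<xi>)\<^sup>2)"
      using t by (subst cos_transform_gauss) (auto simp: powr_minus mult_ac)
    finally show ?thesis .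
  qed
  have "integrable lborel (\<lambda>y. ?g (x - y))"
    by (rule integral_lborel_reflect(2)[OF g])
  then have "integrable lborel (\<lambda>y. cos_transform ?m y * ?g (x - y))"
    by (intro integrable_mult_bounded[OF _ _ cos_transform_bound[OF m]]) auto
  then have i: "integrable lborel (\<lambda>y. ?g (x - y) * cos_transform ?m y)"
    by (simp add: mult.commute)
  have "heat_kernel \<alpha> t x = (LINT y|lborel. ?g (x - y) * cos_transform ?m y) / (2 * pi) ^ CARD('n)"
    unfolding heat_kernel_def convol_def stable_kernel_eq[OF \<alpha> t]
    by (subst integral_completion) auto
  also have "(LINT y|lborel. ?g (x - y) * cos_transform ?m y) = (LINT y|lborel. ?g y * cos_transform ?m (x - y))"
    using integral_lborel_reflect(1)[OF i, of x] by simp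
  also have "\<dots> = cos_transform (symbol_exp \<alpha> t) x"
    by (subst cos_transform_convolution[OF g m]) (simp_all add: gt symbol_exp_def[abs_def] gauss_kernel_def)
  finally show ?thesis
    by (simp add: mixed_kernel_def)
qed

section \<open>The time weight\<close>

text \<open>A Borel, everywhere positive version of the weight; \<open>L1_loc_halfline_borel\<close>
  provides it. Positivity makes \<open>H\<close> strictly increasing on the half-line, hence usable
  as a clock.\<close>

locale positive_density =
  fixes h :: "real \<Rightarrow> real"
  assumes h_measurable[measurable]: "h \<in> borel_measurable borel"
    and h_pos: "\<And>s. 0 < h s"
    and h_integrable: "\<And>T. 0 < T \<Longrightarrow> set_integrable lborel {0<..<T} h"
begin

definition H :: "real \<Rightarrow> real" where
  "H t = (LINT s:{0<..<t}|lborel. h s)"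

lemma h_integrable': "set_integrable lborel {0<..<T} h"
  using h_integrable[of T] by (cases "0 < T") (auto simp: set_integrable_def)

lemma H_diff:
  assumes "0 \<le> r" "r \<le> t"
  shows "(\<integral>\<^sup>+s. ennreal (h s) * indicator {r<..<t} s \<partial>lborel) = ennreal (H t - H r)"
    and "0 \<le> H t - H r"
proof -
  have i: "set_integrable lborel {r<..<t} h"
    using assms by (intro set_integrable_subset[OF h_integrable'[of t]]) auto
  have "(LINT s:{0<..<t}|lborel. h s) = (LINT s:{0<..<r} \<union> {r<..<t}|lborel. h s)"
    unfolding set_lebesgue_integral_def
  proof (rule integral_cong_AE)
    show "AE s in lborel. indicat_real {0<..<t} s *\<^sub>R h s = indicat_real ({0<..<r} \<union> {r<..<t}) s *\<^sub>R h s"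
      using AE_lborel_singleton[of r] by eventually_elim (use assms in \<open>auto simp: indicator_def\<close>)
  qed auto
  also have "\<dots> = H r + (LINT s:{r<..<t}|lborel. h s)"
    unfolding H_def using i h_integrable' by (intro set_integral_Un) auto
  finally have *: "H t - H r = (LINT s:{r<..<t}|lborel. h s)"
    by (simp add: H_def)
  show "0 \<le> H t - H r"
    unfolding * set_lebesgue_integral_def using h_pos by (intro Bochner_Integration.integral_nonneg) (simp add: less_imp_le)
  have "(\<integral>\<^sup>+s. ennreal (h s) * indicator {r<..<t} s \<partial>lborel) = (\<integral>\<^sup>+s. ennreal (indicator {r<..<t} s *\<^sub>R h s) \<partial>lborel)"
    by (intro nn_integral_cong) (auto simp: indicator_def)
  also have "\<dots> = ennreal (LINT s:{r<..<t}|lborel. h s)"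
    unfolding set_lebesgue_integral_def using i h_pos
    by (intro nn_integral_eq_integral) (auto simp: set_integrable_def less_imp_le)
  finally show "(\<integral>\<^sup>+s. ennreal (h s) * indicator {r<..<t} s \<partial>lborel) = ennreal (H t - H r)"
    by (simp add: *)
qed

lemma H_nonpos: "t \<le> 0 \<Longrightarrow> H t = 0"
  by (simp add: H_def set_lebesgue_integral_def)

lemma H_mono: "mono H"
proof
  fix r t :: real assume "r \<le> t"
  then show "H r \<le> H t"
    using H_diff(2)[of 0 t] H_diff(2)[of r t] by (cases "t \<le> 0"; cases "r \<le> 0") (auto simp: H_nonpos)
qed

lemma H_nonneg: "0 \<le> H t"
  using monoD[OF H_mono, of "min 0 t" t] by (simp add: H_nonpos)

lemma H_measurable[measurable]: "H \<in> borel_measurable borel"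
  by (rule borel_measurable_mono[OF H_mono])

lemma H_strict_mono:
  assumes "0 \<le> r" "r < t"
  shows "H r < H t"
proof (rule ccontr)
  assume "\<not> H r < H t"
  then have "(\<integral>\<^sup>+s. ennreal (h s) * indicator {r<..<t} s \<partial>lborel) = 0"
    using H_diff(1)[of r t] assms by (simp add: ennreal_neg)
  then have "AE s in lborel. ennreal (h s) * indicator {r<..<t} s = 0"
    by (subst (asm) nn_integral_0_iff_AE) auto
  then have "AE s in lborel. s \<notin> {r<..<t}"
  proof eventually_elim
    case (elim s)
    then show ?case
      using h_pos[of s] by (auto simp: indicator_def ennreal_eq_0_iff split: if_splits)
  qed
  then have "emeasure lborel {r<..<t} = 0"
    using AE_iff_null_sets[of "{r<..<t}" lborel] by auto
  then show False
    using assms by simp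
qed

lemma H_continuous: "continuous_on {0..T} H"
proof -
  have eq: "H t = integral {0..t} h" if "t \<in> {0..T}" for t
    unfolding H_def using set_borel_integral_eq_integral(2)[OF h_integrable'[of t]]
    by (simp add: integral_open_interval_real)
  have "h integrable_on {0<..<T}"
    by (rule set_borel_integral_eq_integral(1)[OF h_integrable'])
  then have "h integrable_on {0..T}"
    by (simp add: integrable_on_open_interval_real)
  from indefinite_integral_continuous_1[OF this] show ?thesis
    by (rule continuous_on_eq) (simp add: eq)
qed

text \<open>As \<open>h\<close> is only integrable, \<open>H\<close> need not be differentiable
  everywhere, so the substitution is made through measures: the image under \<open>H\<close> of h(s)
  ds on (r, t) and Lebesgue measure on [H r, H t] give every half-line above x the same finite mass,
  and therefore agree.\<close>

lemma nn_integral_substitution_H: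
  assumes rt: "0 \<le> r" "r \<le> t" and [measurable]: "\<phi> \<in> borel_measurable borel"
  shows "(\<integral>\<^sup>+s. \<phi> (H s) * ennreal (h s) * indicator {r<..<t} s \<partial>lborel) =
    (\<integral>\<^sup>+z. \<phi> z * indicator {H r..H t} z \<partial>lborel)"
proof -
  let ?M = "distr (density lborel (\<lambda>s. ennreal (h s) * indicator {r<..<t} s)) borel H"
  let ?N = "density lborel (indicator {H r..H t})"
  have M: "emeasure ?M {x<..} = (\<integral>\<^sup>+s. ennreal (h s) * indicator {r<..<t} s * indicator {x<..} (H s) \<partial>lborel)" for x
    by (subst emeasure_distr, simp, simp, subst emeasure_density)
       (auto intro!: nn_integral_cong simp: indicator_def measurable_sets_borel[OF H_measurable])
  have N: "emeasure ?N {x<..} = emeasure lborel ({H r..H t} \<inter> {x<..})" for x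
    by (subst emeasure_density) (auto simp: indicator_inter_arith[symmetric] simp flip: nn_integral_indicator)
  have "?M = ?N"
  proof (rule measure_eqI_lessThan)
    fix x
    have "emeasure ?M {x<..} \<le> (\<integral>\<^sup>+s. ennreal (h s) * indicator {r<..<t} s \<partial>lborel)"
      unfolding M by (intro nn_integral_mono) (auto simp: indicator_def)
    also have "\<dots> < \<infinity>"
      using rt by (simp add: H_diff)
    finally show "emeasure ?M {x<..} < \<infinity>" .
    consider "x < H r" | "H r \<le> x" "x \<le> H t" | "H t < x"
      by linarith
    then show "emeasure ?M {x<..} = emeasure ?N {x<..}"
    proof cases
      case 1
      have "emeasure ?M {x<..} = (\<integral>\<^sup>+s. ennreal (h s) * indicator {r<..<t} s \<partial>lborel)"
      proof -
        have "x < H s" if "r < s" for s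
          using 1 monoD[OF H_mono, of r s] that by simp
        then show ?thesis
          unfolding M by (intro nn_integral_cong) (auto simp: indicator_def)
      qed
      also have "\<dots> = ennreal (H t - H r)"
        using rt by (simp add: H_diff)
      also have "{H r..H t} \<inter> {x<..} = {H r..H t}"
        using 1 by auto
      then have "ennreal (H t - H r) = emeasure ?N {x<..}"
        unfolding N using H_diff(2)[OF rt] by simp
      finally show ?thesis .
    next
      case 2
      \<comment> \<open>A preimage of x under \<open>H\<close>; by strict monotonicity, H s > x
        means s > s0.\<close>
      obtain s0 where s0: "r \<le> s0" "s0 \<le> t" "H s0 = x"
        using IVT'[of H r x t] 2 rt continuous_on_subset[OF H_continuous, of "{r..t}" t] by auto
      have gt: "x < H s \<longleftrightarrow> s0 < s" if "0 \<le> s" for s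
        using H_strict_mono[of s0 s] H_strict_mono[of s s0] s0 that rt by (cases s s0 rule: linorder_cases) auto
      have "emeasure ?M {x<..} = (\<integral>\<^sup>+s. ennreal (h s) * indicator {s0<..<t} s \<partial>lborel)"
        unfolding M using rt s0 by (intro nn_integral_cong) (auto simp: indicator_def gt)
      also have "\<dots> = ennreal (H t - x)"
        using rt s0 by (simp add: H_diff)
      also have "{H r..H t} \<inter> {x<..} = {x<..H t}"
        using 2 by auto
      then have "ennreal (H t - x) = emeasure ?N {x<..}"
        unfolding N using 2 by simp
      finally show ?thesis .
    next
      case 3
      have "\<not> x < H s" if "s < t" for s
        using 3 monoD[OF H_mono, of s t] that by simp
      then have "emeasure ?M {x<..} = (\<integral>\<^sup>+s. 0 \<partial>(lborel :: real measure))"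
        unfolding M by (intro nn_integral_cong) (auto simp: indicator_def)
      then have "emeasure ?M {x<..} = 0"
        by simp
      moreover have "{H r..H t} \<inter> {x<..} = {}"
        using 3 by auto
      ultimately show ?thesis
        unfolding N by simp
    qed
  qed auto
  then have "(\<integral>\<^sup>+z. \<phi> z \<partial>?M) = (\<integral>\<^sup>+z. \<phi> z \<partial>?N)"
    by simp
  then show ?thesis
    by (simp add: nn_integral_distr nn_integral_density mult_ac)
qed

text \<open>In the variable z = H s the integrands have explicit primitives. The forward form, with
  the starting time fixed, removes the damping in \<open>mild_equation\<close>; the backward form,
  with the final time fixed, gives the total weight in \<open>step_le\<close>.\<close>

lemma
  assumes rt: "0 \<le> r" "r \<le> t" and L: "0 \<le> L"
  shows nn_integral_exp_H_forward:
    "(\<integral>\<^sup>+s. ennreal (L * h s * exp (- L * (H s - H r))) * indicator {r<..<t} s \<partial>lborel) = ennreal (1 - exp (- L * (H t - H r)))"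
  and nn_integral_exp_H_backward:
    "(\<integral>\<^sup>+s. ennreal (L * h s * exp (- L * (H t - H s))) * indicator {r<..<t} s \<partial>lborel) = ennreal (1 - exp (- L * (H t - H r)))"
proof -
  have Hrt: "H r \<le> H t"
    using H_diff(2)[OF rt] by simp
  have h0: "0 \<le> h s" for s
    using h_pos[of s] by simp
  have "(\<integral>\<^sup>+s. ennreal (L * h s * exp (- L * (H s - H r))) * indicator {r<..<t} s \<partial>lborel) =
    (\<integral>\<^sup>+s. ennreal (L * exp (- L * (H s - H r))) * ennreal (h s) * indicator {r<..<t} s \<partial>lborel)"
    using L h0 by (intro nn_integral_cong) (simp add: ennreal_mult[symmetric] mult_ac)
  also have "\<dots> = (\<integral>\<^sup>+z. ennreal (L * exp (- L * (z - H r))) * indicator {H r..H t} z \<partial>lborel)"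
    by (rule nn_integral_substitution_H[OF rt]) measurable
  also have "\<dots> = ennreal (- exp (- L * (H t - H r)) - (- exp (- L * (H r - H r))))"
    by (rule nn_integral_FTC_Icc) (use Hrt L in \<open>auto intro!: derivative_eq_intros\<close>)
  finally show "(\<integral>\<^sup>+s. ennreal (L * h s * exp (- L * (H s - H r))) * indicator {r<..<t} s \<partial>lborel) = ennreal (1 - exp (- L * (H t - H r)))"
    by simp
  have "(\<integral>\<^sup>+s. ennreal (L * h s * exp (- L * (H t - H s))) * indicator {r<..<t} s \<partial>lborel) =
    (\<integral>\<^sup>+s. ennreal (L * exp (- L * (H t - H s))) * ennreal (h s) * indicator {r<..<t} s \<partial>lborel)"
    using L h0 by (intro nn_integral_cong) (simp add: ennreal_mult[symmetric] mult_ac)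
  also have "\<dots> = (\<integral>\<^sup>+z. ennreal (L * exp (- L * (H t - z))) * indicator {H r..H t} z \<partial>lborel)"
    by (rule nn_integral_substitution_H[OF rt]) measurable
  also have "\<dots> = ennreal (exp (- L * (H t - H t)) - exp (- L * (H t - H r)))"
    by (rule nn_integral_FTC_Icc) (use Hrt L in \<open>auto intro!: derivative_eq_intros\<close>)
  finally show "(\<integral>\<^sup>+s. ennreal (L * h s * exp (- L * (H t - H s))) * indicator {r<..<t} s \<partial>lborel) = ennreal (1 - exp (- L * (H t - H r)))"
    by simp
qed

end

section \<open>Monotone iteration for the damped equation\<close>

lemma borel_measurable_indicator_Ioo[measurable (raw)]:
  fixes a b c :: "'a \<Rightarrow> real"
  assumes [measurable]: "a \<in> borel_measurable N" "b \<in> borel_measurable N" "c \<in> borel_measurable N"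
  shows "(\<lambda>z. indicator {a z<..<b z} (c z) :: ennreal) \<in> borel_measurable N"
proof -
  have "(\<lambda>z. if a z < c z \<and> c z < b z then 1 else 0 :: ennreal) \<in> borel_measurable N"
    by measurable
  then show ?thesis
    by (simp add: indicator_def)
qed

lemma borel_measurable_curried:
  assumes "(\<lambda>(t, x). w t x) \<in> borel_measurable (borel \<Otimes>\<^sub>M borel)"
    and "a \<in> borel_measurable N" "b \<in> borel_measurable N"
  shows "(\<lambda>z. w (a z) (b z)) \<in> borel_measurable N"
  using measurable_compose[OF measurable_Pair[OF assms(2,3)] assms(1)] by simp

text \<open>Fourier analysis ends here: of the kernel only sign, mass, semigroup law and L^1
  continuity at positive times are kept. \<open>G\<close> is the clock of the diffusion, and its
  strict growth keeps \<open>G t - G s\<close> positive for s < t. \<open>f_slope\<close> is the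
  bound from above on the slope of \<open>f\<close> that makes L r - f r nondecreasing on
  [0, M].\<close>

locale evolution = positive_density h for h :: "real \<Rightarrow> real" +
  fixes K :: "real \<Rightarrow> 'a::euclidean_space \<Rightarrow> real" and G :: "real \<Rightarrow> real"
    and v :: "'a \<Rightarrow> real" and f :: "real \<Rightarrow> real" and M L :: real
  assumes K_measurable: "(\<lambda>(t, x). K t x) \<in> borel_measurable (borel \<Otimes>\<^sub>M borel)"
    and K_nonneg: "\<And>t x. 0 < t \<Longrightarrow> 0 \<le> K t x"
    and K_mass: "\<And>t. 0 < t \<Longrightarrow> (\<integral>\<^sup>+x. ennreal (K t x) \<partial>lborel) = 1"
    and K_semigroup: "\<And>s t x. 0 < s \<Longrightarrow> 0 < t \<Longrightarrow>
      (\<integral>\<^sup>+y. ennreal (K s (x - y)) * ennreal (K t y) \<partial>lborel) = ennreal (K (s + t) x)"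
    and K_continuous: "\<And>T t. T \<longlonglongrightarrow> t \<Longrightarrow> 0 < t \<Longrightarrow>
      (\<lambda>n. \<integral>\<^sup>+x. ennreal \<bar>K (T n) x - K t x\<bar> \<partial>lborel) \<longlonglongrightarrow> 0"
    and G_measurable[measurable]: "G \<in> borel_measurable borel"
    and G_0: "G 0 = 0"
    and G_strict_mono: "\<And>s t. 0 \<le> s \<Longrightarrow> s < t \<Longrightarrow> G s < G t"
    and G_continuous: "\<And>t. 0 < t \<Longrightarrow> isCont G t"
    and v_measurable[measurable]: "v \<in> borel_measurable borel"
    and v_range: "\<And>x. 0 \<le> v x" "\<And>x. v x \<le> M"
    and f_measurable[measurable]: "f \<in> borel_measurable borel"
    and f_0: "f 0 = 0"
    and f_nonneg: "\<And>r. 0 \<le> r \<Longrightarrow> r \<le> M \<Longrightarrow> 0 \<le> f r"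
    and f_continuous: "continuous_on {0..M} f"
    and L_nonneg: "0 \<le> L"
    and f_slope: "\<And>r r'. 0 \<le> r \<Longrightarrow> r \<le> r' \<Longrightarrow> r' \<le> M \<Longrightarrow> f r' - f r \<le> L * (r' - r)"
begin

lemma M_nonneg: "0 \<le> M"
  using v_range order_trans by blast

lemmas K_measurable'[measurable (raw)] = borel_measurable_curried[OF K_measurable]

definition g :: "real \<Rightarrow> real" where
  "g r = L * r - f r"

lemma g_measurable[measurable]: "g \<in> borel_measurable borel"
  unfolding g_def[abs_def] by measurable

lemma g_mono: "0 \<le> r \<Longrightarrow> r \<le> r' \<Longrightarrow> r' \<le> M \<Longrightarrow> g r \<le> g r'"
  using f_slope[of r r'] by (simp add: g_def algebra_simps)

lemma g_nonneg: "0 \<le> r \<Longrightarrow> r \<le> M \<Longrightarrow> 0 \<le> g r"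
  using g_mono[of 0 r] by (simp add: g_def f_0)

lemma g_le: "0 \<le> r \<Longrightarrow> r \<le> M \<Longrightarrow> g r \<le> L * M"
  using f_nonneg[of r] mult_left_mono[OF _ L_nonneg, of r M] by (simp add: g_def)

lemma f_le: "0 \<le> r \<Longrightarrow> r \<le> M \<Longrightarrow> f r \<le> L * M"
  using g_nonneg[of r] mult_left_mono[OF _ L_nonneg, of r M] by (simp add: g_def)

lemma g_continuous: "continuous_on {0..M} g"
  unfolding g_def[abs_def] by (intro continuous_intros f_continuous)

lemma G_pos: "0 < t \<Longrightarrow> 0 < G t"
  using G_strict_mono[of 0 t] by (simp add: G_0)

lemma h_nonneg: "0 \<le> h s"
  using h_pos[of s] by simp

text \<open>The diffusion semigroup for positive \<open>a\<close>, with values in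
  \<open>ennreal\<close> so that Tonelli's theorem applies freely.\<close>

definition S :: "real \<Rightarrow> ('a \<Rightarrow> ennreal) \<Rightarrow> 'a \<Rightarrow> ennreal" where
  "S a \<phi> x = (\<integral>\<^sup>+y. ennreal (K a (x - y)) * \<phi> y \<partial>lborel)"

lemma S_measurable[measurable (raw)]:
  assumes [measurable]: "a \<in> borel_measurable N" "(\<lambda>(z, y). \<phi> z y) \<in> borel_measurable (N \<Otimes>\<^sub>M borel)"
    "b \<in> borel_measurable N"
  shows "(\<lambda>z. S (a z) (\<phi> z) (b z)) \<in> borel_measurable N"
  unfolding S_def by measurable

lemma S_mono: "(\<And>y. \<phi> y \<le> \<psi> y) \<Longrightarrow> S a \<phi> x \<le> S a \<psi> x"
  unfolding S_def by (intro nn_integral_mono mult_left_mono) auto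

lemma K_mass_reflect:
  assumes "0 < a"
  shows "(\<integral>\<^sup>+y. ennreal (K a (x - y)) \<partial>lborel) = 1"
  using K_mass[OF assms] nn_integral_lborel_affine[of "\<lambda>y. ennreal (K a y)" "-1" x] by simp

lemma S_const:
  assumes "0 < a"
  shows "S a (\<lambda>_. c) x = c"
  unfolding S_def using K_mass_reflect[OF assms] by (simp add: nn_integral_multc)

lemma S_add:
  assumes [measurable]: "\<phi> \<in> borel_measurable borel" "\<psi> \<in> borel_measurable borel"
  shows "S a (\<lambda>y. \<phi> y + \<psi> y) x = S a \<phi> x + S a \<psi> x"
  unfolding S_def by (simp add: distrib_left nn_integral_add)

lemma S_cmult:
  assumes [measurable]: "\<phi> \<in> borel_measurable borel"
  shows "S a (\<lambda>y. c * \<phi> y) x = c * S a \<phi> x"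
  unfolding S_def by (simp add: mult.left_commute nn_integral_cmult)

lemma S_nn_integral:
  assumes [measurable]: "(\<lambda>(r, y). \<psi> r y) \<in> borel_measurable (borel \<Otimes>\<^sub>M borel)"
  shows "S a (\<lambda>y. \<integral>\<^sup>+r. \<psi> r y \<partial>(lborel :: real measure)) x = (\<integral>\<^sup>+r. S a (\<psi> r) x \<partial>lborel)"
proof -
  have "S a (\<lambda>y. \<integral>\<^sup>+r. \<psi> r y \<partial>lborel) x = (\<integral>\<^sup>+y. \<integral>\<^sup>+r. ennreal (K a (x - y)) * \<psi> r y \<partial>lborel \<partial>lborel)"
    unfolding S_def by (simp add: nn_integral_cmult)
  also have "\<dots> = (\<integral>\<^sup>+r. \<integral>\<^sup>+y. ennreal (K a (x - y)) * \<psi> r y \<partial>lborel \<partial>lborel)"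
    by (rule lborel_pair.Fubini') simp
  finally show ?thesis
    by (simp add: S_def)
qed

lemma S_semigroup:
  assumes a: "0 < a" and b: "0 < b" and [measurable]: "\<phi> \<in> borel_measurable borel"
  shows "S a (S b \<phi>) x = S (a + b) \<phi> x"
proof -
  have "S a (S b \<phi>) x = (\<integral>\<^sup>+y. \<integral>\<^sup>+z. ennreal (K a (x - y)) * (ennreal (K b (y - z)) * \<phi> z) \<partial>lborel \<partial>lborel)"
    unfolding S_def by (simp add: nn_integral_cmult)
  also have "\<dots> = (\<integral>\<^sup>+z. \<integral>\<^sup>+y. ennreal (K a (x - y)) * (ennreal (K b (y - z)) * \<phi> z) \<partial>lborel \<partial>lborel)"
    by (rule lborel_pair.Fubini') simp
  also have "\<dots> = (\<integral>\<^sup>+z. ennreal (K (a + b) (x - z)) * \<phi> z \<partial>lborel)"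
  proof (rule nn_integral_cong)
    fix z
    have "(\<integral>\<^sup>+y. ennreal (K a (x - y)) * ennreal (K b (y - z)) \<partial>lborel) = (\<integral>\<^sup>+y. ennreal (K a ((x - z) - y)) * ennreal (K b y) \<partial>lborel)"
      using nn_integral_lborel_affine[of "\<lambda>y. ennreal (K a (x - y)) * ennreal (K b (y - z))" 1 z]
      by (simp add: algebra_simps)
    also have "\<dots> = ennreal (K (a + b) (x - z))"
      by (rule K_semigroup[OF a b])
    finally show "(\<integral>\<^sup>+y. ennreal (K a (x - y)) * (ennreal (K b (y - z)) * \<phi> z) \<partial>lborel) = ennreal (K (a + b) (x - z)) * \<phi> z"
      by (simp add: mult.assoc[symmetric] nn_integral_multc)
  qed
  finally show ?thesis
    by (simp add: S_def)
qed

section \<open>Duhamel's map for the damped equation and its increasing iterates\<close>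

definition step :: "(real \<Rightarrow> 'a \<Rightarrow> real) \<Rightarrow> real \<Rightarrow> 'a \<Rightarrow> ennreal" where
  "step w t x = (if t \<le> 0 then ennreal (v x) else
     ennreal (exp (- L * H t)) * S (G t) (\<lambda>y. ennreal (v y)) x +
     (\<integral>\<^sup>+s. ennreal (h s * exp (- L * (H t - H s))) * S (G t - G s) (\<lambda>y. ennreal (g (w s y))) x * indicator {0<..<t} s \<partial>lborel))"

lemma step_measurable:
  assumes [measurable]: "(\<lambda>(t, x). w t x) \<in> borel_measurable (borel \<Otimes>\<^sub>M borel)"
  shows "(\<lambda>(t, x). step w t x) \<in> borel_measurable (borel \<Otimes>\<^sub>M borel)"
proof -
  note [measurable (raw)] = borel_measurable_curried[OF assms]
  have "(\<lambda>z. step w (fst z) (snd z)) \<in> borel_measurable (borel \<Otimes>\<^sub>M borel)"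
    unfolding step_def by measurable
  then show ?thesis
    by (simp add: split_beta')
qed

lemma step_mono:
  assumes "\<And>s y. 0 \<le> w s y" "\<And>s y. w s y \<le> w' s y" "\<And>s y. w' s y \<le> M"
  shows "step w t x \<le> step w' t x"
  unfolding step_def
  by (auto intro!: add_left_mono nn_integral_mono mult_right_mono mult_left_mono S_mono ennreal_leI g_mono assms)

text \<open>The constant M is a supersolution: nonnegativity of \<open>f\<close> gives g \<le> L M,
  and the weights exp(- L H t) of the initial value and 1 - exp(- L H t) of the source add up to
  1.\<close>

lemma step_le:
  assumes w: "\<And>s y. 0 \<le> w s y" "\<And>s y. w s y \<le> M"
  shows "step w t x \<le> ennreal M"
proof (cases "t \<le> 0")
  case True
  then show ?thesis
    using v_range by (simp add: step_def ennreal_leI)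
next
  case False
  then have t: "0 < t" by simp
  have "S (G t) (\<lambda>y. ennreal (v y)) x \<le> S (G t) (\<lambda>y. ennreal M) x"
    by (intro S_mono ennreal_leI v_range)
  then have 1: "S (G t) (\<lambda>y. ennreal (v y)) x \<le> ennreal M"
    by (simp add: S_const G_pos t)
  have 2: "S (G t - G s) (\<lambda>y. ennreal (g (w s y))) x \<le> ennreal (L * M)" if "0 < s" "s < t" for s
  proof -
    have "S (G t - G s) (\<lambda>y. ennreal (g (w s y))) x \<le> S (G t - G s) (\<lambda>y. ennreal (L * M)) x"
      by (intro S_mono ennreal_leI g_le w)
    then show ?thesis
      using G_strict_mono[of s t] that by (simp add: S_const)
  qed
  have "(\<integral>\<^sup>+s. ennreal (h s * exp (- L * (H t - H s))) * S (G t - G s) (\<lambda>y. ennreal (g (w s y))) x * indicator {0<..<t} s \<partial>lborel)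
    \<le> (\<integral>\<^sup>+s. ennreal M * (ennreal (L * h s * exp (- L * (H t - H s))) * indicator {0<..<t} s) \<partial>lborel)"
  proof (rule nn_integral_mono)
    fix s
    show "ennreal (h s * exp (- L * (H t - H s))) * S (G t - G s) (\<lambda>y. ennreal (g (w s y))) x * indicator {0<..<t} s
      \<le> ennreal M * (ennreal (L * h s * exp (- L * (H t - H s))) * indicator {0<..<t} s)"
    proof (cases "s \<in> {0<..<t}")
      case True
      then have "ennreal (h s * exp (- L * (H t - H s))) * S (G t - G s) (\<lambda>y. ennreal (g (w s y))) x
        \<le> ennreal (h s * exp (- L * (H t - H s))) * ennreal (L * M)"
        by (intro mult_left_mono 2) auto
      also have "\<dots> = ennreal M * ennreal (L * h s * exp (- L * (H t - H s)))"
        using L_nonneg M_nonneg h_nonneg by (simp add: ennreal_mult[symmetric] mult_ac)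
      finally show ?thesis
        using True by simp
    qed simp
  qed
  also have "\<dots> = ennreal M * ennreal (1 - exp (- L * (H t - H 0)))"
    using nn_integral_exp_H_backward[of 0 t L] t L_nonneg by (simp add: nn_integral_cmult)
  finally have "step w t x \<le> ennreal (exp (- L * H t)) * ennreal M + ennreal M * ennreal (1 - exp (- L * H t))"
    unfolding step_def using False 1 by (simp add: H_nonpos) (intro add_mono mult_left_mono; simp)
  also have "\<dots> = ennreal (exp (- L * H t) * M + M * (1 - exp (- L * H t)))"
    using L_nonneg H_nonneg M_nonneg by (simp add: ennreal_mult[symmetric] ennreal_plus[symmetric] del: ennreal_plus)
  finally show ?thesis
    by (simp add: algebra_simps)
qed

primrec iterate :: "nat \<Rightarrow> real \<Rightarrow> 'a \<Rightarrow> real" where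
  "iterate 0 = (\<lambda>t x. 0)"
| "iterate (Suc k) = (\<lambda>t x. enn2real (step (iterate k) t x))"

lemma iterate_range: "0 \<le> iterate k t x" "iterate k t x \<le> M"
proof -
  have "(\<forall>t x. 0 \<le> iterate k t x \<and> iterate k t x \<le> M)"
  proof (induction k)
    case (Suc k)
    then have "step (iterate k) t x \<le> ennreal M" for t x
      by (intro step_le) auto
    then show ?case
      using M_nonneg by (auto simp: enn2real_leI)
  qed (simp add: M_nonneg)
  then show "0 \<le> iterate k t x" "iterate k t x \<le> M"
    by auto
qed

text \<open>The bound by M shows that \<open>enn2real\<close> discards no infinite value.\<close>

lemma ennreal_iterate_Suc: "ennreal (iterate (Suc k) t x) = step (iterate k) t x"
proof -
  have "step (iterate k) t x \<le> ennreal M"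
    by (intro step_le iterate_range)
  then have "step (iterate k) t x < top"
    by (rule le_less_trans) simp
  then show ?thesis
    by simp
qed

lemma iterate_measurable[measurable]: "(\<lambda>(t, x). iterate k t x) \<in> borel_measurable (borel \<Otimes>\<^sub>M borel)"
  by (induction k) (use step_measurable in \<open>auto simp: split_beta'\<close>)

lemma iterate_Suc_le: "iterate k t x \<le> iterate (Suc k) t x"
proof (induction k arbitrary: t x)
  case (Suc k)
  have "step (iterate k) t x \<le> step (iterate (Suc k)) t x"
    by (intro step_mono iterate_range Suc.IH)
  then have "ennreal (iterate (Suc k) t x) \<le> ennreal (iterate (Suc (Suc k)) t x)"
    by (simp only: ennreal_iterate_Suc)
  then show ?case
    by (subst (asm) ennreal_le_iff) (rule iterate_range)
qed simp

definition U :: "real \<Rightarrow> 'a \<Rightarrow> real" where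
  "U t x = (SUP k. iterate k t x)"

lemma iterate_tendsto_U: "(\<lambda>k. iterate k t x) \<longlonglongrightarrow> U t x"
  unfolding U_def
  by (intro LIMSEQ_incseq_SUP incseq_SucI iterate_Suc_le bdd_aboveI[where M=M]) (auto simp: iterate_range)

lemma U_range: "0 \<le> U t x" "U t x \<le> M"
  using LIMSEQ_le_const[OF iterate_tendsto_U] LIMSEQ_le_const2[OF iterate_tendsto_U] iterate_range by blast+

lemma U_measurable[measurable]: "(\<lambda>(t, x). U t x) \<in> borel_measurable (borel \<Otimes>\<^sub>M borel)"
  by (rule borel_measurable_LIMSEQ_metric[of "\<lambda>k (t, x). iterate k t x"]) (auto intro: iterate_tendsto_U)

lemmas U_measurable'[measurable (raw)] = borel_measurable_curried[OF U_measurable]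
lemmas iterate_measurable'[measurable (raw)] = borel_measurable_curried[OF iterate_measurable]

text \<open>Monotone convergence in space and then in time: \<open>g\<close> is nondecreasing and
  continuous on [0, M], so \<open>g\<close> of the iterates increases to \<open>g\<close> of their
  limit. The fixed-point identity thus holds at every t and x.\<close>

lemma ennreal_U: "ennreal (U t x) = step U t x"
proof -
  have g_mono': "g (iterate k s y) \<le> g (iterate (Suc k) s y)" for k s y
    by (intro g_mono iterate_range iterate_Suc_le)
  have g_lim: "(\<lambda>k. ennreal (g (iterate k s y))) \<longlonglongrightarrow> ennreal (g (U s y))" for s y
    by (intro tendsto_ennrealI continuous_on_tendsto_compose[OF g_continuous iterate_tendsto_U])
       (auto simp: iterate_range U_range)
  have S_lim: "(\<lambda>k. S a (\<lambda>y. ennreal (g (iterate k s y))) x) \<longlonglongrightarrow> S a (\<lambda>y. ennreal (g (U s y))) x" for a s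
    unfolding S_def
  proof (rule nn_integral_LIMSEQ)
    show "incseq (\<lambda>k y. ennreal (K a (x - y)) * ennreal (g (iterate k s y)))"
      by (intro incseq_SucI le_funI mult_left_mono ennreal_leI g_mono') auto
    show "(\<lambda>k. ennreal (K a (x - y)) * ennreal (g (iterate k s y))) \<longlonglongrightarrow> ennreal (K a (x - y)) * ennreal (g (U s y))" for y
      by (intro ennreal_tendsto_cmult g_lim) simp
  qed measurable
  have "(\<lambda>k. step (iterate k) t x) \<longlonglongrightarrow> step U t x"
  proof (cases "t \<le> 0")
    case False
    have "(\<lambda>k. \<integral>\<^sup>+s. ennreal (h s * exp (- L * (H t - H s))) * S (G t - G s) (\<lambda>y. ennreal (g (iterate k s y))) x * indicator {0<..<t} s \<partial>lborel)
      \<longlonglongrightarrow> (\<integral>\<^sup>+s. ennreal (h s * exp (- L * (H t - H s))) * S (G t - G s) (\<lambda>y. ennreal (g (U s y))) x * indicator {0<..<t} s \<partial>lborel)"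
    proof (rule nn_integral_LIMSEQ)
      show "incseq (\<lambda>k s. ennreal (h s * exp (- L * (H t - H s))) * S (G t - G s) (\<lambda>y. ennreal (g (iterate k s y))) x * indicator {0<..<t} s)"
        by (intro incseq_SucI le_funI mult_right_mono mult_left_mono S_mono ennreal_leI g_mono') auto
      show "(\<lambda>k. ennreal (h s * exp (- L * (H t - H s))) * S (G t - G s) (\<lambda>y. ennreal (g (iterate k s y))) x * indicator {0<..<t} s)
        \<longlonglongrightarrow> ennreal (h s * exp (- L * (H t - H s))) * S (G t - G s) (\<lambda>y. ennreal (g (U s y))) x * indicator {0<..<t} s" for s
        using ennreal_tendsto_cmult[OF _ S_lim] by (cases "s \<in> {0<..<t}") auto
    qed measurable
    then show ?thesis
      unfolding step_def using False by (simp add: tendsto_add)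
  qed (simp add: step_def)
  moreover have "(\<lambda>k. ennreal (iterate (Suc k) t x)) \<longlonglongrightarrow> ennreal (U t x)"
    using LIMSEQ_Suc[OF iterate_tendsto_U] by (intro tendsto_ennrealI)
  ultimately show ?thesis
    unfolding ennreal_iterate_Suc using LIMSEQ_unique by blast
qed

subsection \<open>The mild equation and continuity in time\<close>

lemma S_measurable_space[measurable]:
  assumes [measurable]: "\<phi> \<in> borel_measurable borel"
  shows "S a \<phi> \<in> borel_measurable borel"
  unfolding S_def[abs_def] by measurable

text \<open>Used with \<open>f\<close>, as the absorption term of the original equation, and with
  \<open>g\<close>, as the undamped source; both are finite, which is what permits cancelling
  them.\<close>

definition absorbed :: "(real \<Rightarrow> real) \<Rightarrow> real \<Rightarrow> 'a \<Rightarrow> ennreal" where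
  "absorbed \<phi> t x = (\<integral>\<^sup>+s. ennreal (h s) * S (G t - G s) (\<lambda>y. ennreal (\<phi> (U s y))) x * indicator {0<..<t} s \<partial>lborel)"

lemma absorbed_finite:
  assumes t: "0 < t" and \<phi>: "\<And>r. 0 \<le> r \<Longrightarrow> r \<le> M \<Longrightarrow> \<phi> r \<le> C"
  shows "absorbed \<phi> t x < top"
proof -
  have "absorbed \<phi> t x \<le> (\<integral>\<^sup>+s. ennreal C * (ennreal (h s) * indicator {0<..<t} s) \<partial>lborel)"
    unfolding absorbed_def
  proof (rule nn_integral_mono)
    fix s
    have "S (G t - G s) (\<lambda>y. ennreal (\<phi> (U s y))) x \<le> S (G t - G s) (\<lambda>y. ennreal C) x"
      by (intro S_mono ennreal_leI \<phi> U_range)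
    then show "ennreal (h s) * S (G t - G s) (\<lambda>y. ennreal (\<phi> (U s y))) x * indicator {0<..<t} s \<le> ennreal C * (ennreal (h s) * indicator {0<..<t} s)"
      using G_strict_mono[of s t]
      by (cases "s \<in> {0<..<t}") (auto simp: S_const mult.commute[of "ennreal C"] intro!: mult_left_mono)
  qed
  also have "\<dots> = ennreal C * ennreal (H t - H 0)"
    using t by (simp add: nn_integral_cmult H_diff)
  also have "\<dots> < top"
    by (simp add: ennreal_mult_less_top)
  finally show ?thesis .
qed

lemma absorbed_f_finite: "0 < t \<Longrightarrow> absorbed f t x < top"
  by (rule absorbed_finite[where \<phi> = f, OF _ f_le])

lemma absorbed_g_finite: "0 < t \<Longrightarrow> absorbed g t x < top"
  by (rule absorbed_finite[where \<phi> = g, OF _ g_le])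

text \<open>The fixed-point identity at time s, transported to time t; the semigroup law merges the
  two diffusion times under the integral.\<close>

lemma S_U:
  assumes s: "0 < s" "s < t"
  shows "S (G t - G s) (\<lambda>y. ennreal (U s y)) x =
    ennreal (exp (- L * H s)) * S (G t) (\<lambda>y. ennreal (v y)) x +
    (\<integral>\<^sup>+r. ennreal (h r * exp (- L * (H s - H r))) * S (G t - G r) (\<lambda>y. ennreal (g (U r y))) x * indicator {0<..<s} r \<partial>lborel)"
proof -
  let ?c = "\<lambda>r. ennreal (h r * exp (- L * (H s - H r))) * indicator {0<..<s} r"
  let ?q = "\<lambda>r y. ennreal (g (U r y))"
  have pos: "0 < G t - G s"
    using G_strict_mono[of s t] s by simp
  have "S (G t - G s) (\<lambda>y. ennreal (U s y)) x =
    S (G t - G s) (\<lambda>y. ennreal (exp (- L * H s)) * S (G s) (\<lambda>y. ennreal (v y)) y + (\<integral>\<^sup>+r. ?c r * S (G s - G r) (?q r) y \<partial>lborel)) x"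
    unfolding ennreal_U step_def using s by (simp add: mult_ac)
  also have "\<dots> = S (G t - G s) (\<lambda>y. ennreal (exp (- L * H s)) * S (G s) (\<lambda>y. ennreal (v y)) y) x +
      S (G t - G s) (\<lambda>y. \<integral>\<^sup>+r. ?c r * S (G s - G r) (?q r) y \<partial>lborel) x"
    by (rule S_add) measurable
  also have "S (G t - G s) (\<lambda>y. ennreal (exp (- L * H s)) * S (G s) (\<lambda>y. ennreal (v y)) y) x =
      ennreal (exp (- L * H s)) * S (G t - G s) (S (G s) (\<lambda>y. ennreal (v y))) x"
    by (rule S_cmult) measurable
  also have "S (G t - G s) (\<lambda>y. \<integral>\<^sup>+r. ?c r * S (G s - G r) (?q r) y \<partial>lborel) x =
      (\<integral>\<^sup>+r. S (G t - G s) (\<lambda>y. ?c r * S (G s - G r) (?q r) y) x \<partial>lborel)"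
    by (rule S_nn_integral) measurable
  also have "S (G t - G s) (S (G s) (\<lambda>y. ennreal (v y))) x = S (G t) (\<lambda>y. ennreal (v y)) x"
    using pos G_pos[OF s(1)] by (subst S_semigroup) auto
  also have "(\<integral>\<^sup>+r. S (G t - G s) (\<lambda>y. ?c r * S (G s - G r) (?q r) y) x \<partial>lborel) =
     (\<integral>\<^sup>+r. ennreal (h r * exp (- L * (H s - H r))) * S (G t - G r) (?q r) x * indicator {0<..<s} r \<partial>lborel)"
  proof (rule nn_integral_cong)
    fix r
    have "S (G t - G s) (\<lambda>y. ?c r * S (G s - G r) (?q r) y) x = ?c r * S (G t - G s) (S (G s - G r) (?q r)) x"
      by (rule S_cmult) measurable
    also have "\<dots> = ennreal (h r * exp (- L * (H s - H r))) * S (G t - G r) (?q r) x * indicator {0<..<s} r"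
      using S_semigroup[of "G t - G s" "G s - G r" "?q r" x] G_strict_mono[of r s] pos
      by (cases "r \<in> {0<..<s}") auto
    finally show "S (G t - G s) (\<lambda>y. ?c r * S (G s - G r) (?q r) y) x =
      ennreal (h r * exp (- L * (H s - H r))) * S (G t - G r) (?q r) x * indicator {0<..<s} r" .
  qed
  finally show ?thesis .
qed

text \<open>Adding \<open>L h u\<close> to both sides of the damped equation removes the exponential weights again.\<close>

lemma mild_equation:
  assumes t: "0 < t"
  shows "ennreal (U t x) + absorbed f t x = S (G t) (\<lambda>y. ennreal (v y)) x"
proof -
  define V where "V = S (G t) (\<lambda>y. ennreal (v y)) x"
  define q where "q = (\<lambda>r. S (G t - G r) (\<lambda>y. ennreal (g (U r y))) x)"
  have q_measurable[measurable]: "q \<in> borel_measurable borel"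
    unfolding q_def by measurable
  define D where "D = (\<integral>\<^sup>+s. ennreal (h s * exp (- L * (H t - H s))) * q s * indicator {0<..<t} s \<partial>lborel)"
  \<comment> \<open>The damping term of the equation, to be evaluated twice: by transporting the
    fixed-point identity, and by splitting L u into g(u) + f(u).\<close>
  let ?I = "\<integral>\<^sup>+s. ennreal (L * h s) * S (G t - G s) (\<lambda>y. ennreal (U s y)) x * indicator {0<..<t} s \<partial>lborel"
  have U_eq: "ennreal (U t x) = ennreal (exp (- L * H t)) * V + D"
    unfolding ennreal_U step_def V_def D_def q_def using t by simp
  have "?I = (\<integral>\<^sup>+s. ennreal (L * h s * exp (- L * (H s - H 0))) * indicator {0<..<t} s * V +
     (\<integral>\<^sup>+r. ennreal (L * h s) * ennreal (h r * exp (- L * (H s - H r))) * q r * indicator {0<..<s} r * indicator {0<..<t} s \<partial>lborel) \<partial>lborel)"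
  proof (rule nn_integral_cong)
    fix s
    show "ennreal (L * h s) * S (G t - G s) (\<lambda>y. ennreal (U s y)) x * indicator {0<..<t} s =
      ennreal (L * h s * exp (- L * (H s - H 0))) * indicator {0<..<t} s * V +
     (\<integral>\<^sup>+r. ennreal (L * h s) * ennreal (h r * exp (- L * (H s - H r))) * q r * indicator {0<..<s} r * indicator {0<..<t} s \<partial>lborel)"
    proof (cases "s \<in> {0<..<t}")
      case True
      then have "ennreal (L * h s) * S (G t - G s) (\<lambda>y. ennreal (U s y)) x =
        ennreal (L * h s) * (ennreal (exp (- L * H s)) * V) +
        ennreal (L * h s) * (\<integral>\<^sup>+r. ennreal (h r * exp (- L * (H s - H r))) * q r * indicator {0<..<s} r \<partial>lborel)"
        unfolding q_def V_def by (subst S_U) (auto simp: distrib_left)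
      also have "ennreal (L * h s) * (ennreal (exp (- L * H s)) * V) = ennreal (L * h s * exp (- L * (H s - H 0))) * V"
        using L_nonneg h_nonneg by (simp add: H_nonpos ennreal_mult mult.assoc)
      also have "ennreal (L * h s) * (\<integral>\<^sup>+r. ennreal (h r * exp (- L * (H s - H r))) * q r * indicator {0<..<s} r \<partial>lborel) =
        (\<integral>\<^sup>+r. ennreal (L * h s) * ennreal (h r * exp (- L * (H s - H r))) * q r * indicator {0<..<s} r \<partial>lborel)"
        by (subst nn_integral_cmult[symmetric]) (simp_all add: mult.assoc)
      finally show ?thesis
        using True by simp
    qed simp
  qed
  also have "\<dots> = (\<integral>\<^sup>+s. ennreal (L * h s * exp (- L * (H s - H 0))) * indicator {0<..<t} s * V \<partial>lborel) +
     (\<integral>\<^sup>+s. \<integral>\<^sup>+r. ennreal (L * h s) * ennreal (h r * exp (- L * (H s - H r))) * q r * indicator {0<..<s} r * indicator {0<..<t} s \<partial>lborel \<partial>lborel)"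
    by (rule nn_integral_add) measurable
  also have "(\<integral>\<^sup>+s. ennreal (L * h s * exp (- L * (H s - H 0))) * indicator {0<..<t} s * V \<partial>lborel) = ennreal (1 - exp (- L * H t)) * V"
    using nn_integral_exp_H_forward[of 0 t L] t L_nonneg by (simp add: nn_integral_multc H_nonpos)
  also have "(\<integral>\<^sup>+s. \<integral>\<^sup>+r. ennreal (L * h s) * ennreal (h r * exp (- L * (H s - H r))) * q r * indicator {0<..<s} r * indicator {0<..<t} s \<partial>lborel \<partial>lborel) =
    (\<integral>\<^sup>+r. \<integral>\<^sup>+s. ennreal (L * h s) * ennreal (h r * exp (- L * (H s - H r))) * q r * indicator {0<..<s} r * indicator {0<..<t} s \<partial>lborel \<partial>lborel)"
    by (rule lborel_pair.Fubini') measurable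
  \<comment> \<open>For fixed r the inner integral over s in (r, t) is the forward exponential
    integral.\<close>
  also have "\<dots> = (\<integral>\<^sup>+r. ennreal (h r * (1 - exp (- L * (H t - H r)))) * q r * indicator {0<..<t} r \<partial>lborel)"
  proof (rule nn_integral_cong)
    fix r
    show "(\<integral>\<^sup>+s. ennreal (L * h s) * ennreal (h r * exp (- L * (H s - H r))) * q r * indicator {0<..<s} r * indicator {0<..<t} s \<partial>lborel) =
      ennreal (h r * (1 - exp (- L * (H t - H r)))) * q r * indicator {0<..<t} r"
    proof (cases "r \<in> {0<..<t}")
      case True
      have "(\<integral>\<^sup>+s. ennreal (L * h s) * ennreal (h r * exp (- L * (H s - H r))) * q r * indicator {0<..<s} r * indicator {0<..<t} s \<partial>lborel) =
        (\<integral>\<^sup>+s. (ennreal (h r) * q r) * (ennreal (L * h s * exp (- L * (H s - H r))) * indicator {r<..<t} s) \<partial>lborel)"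
        using True L_nonneg h_nonneg
        by (intro nn_integral_cong) (auto simp: indicator_def ennreal_mult mult_ac)
      also have "\<dots> = (ennreal (h r) * q r) * ennreal (1 - exp (- L * (H t - H r)))"
        using True nn_integral_exp_H_forward[of r t L] L_nonneg by (simp add: nn_integral_cmult)
      also have "\<dots> = ennreal (h r * (1 - exp (- L * (H t - H r)))) * q r"
        using True L_nonneg h_nonneg H_diff(2)[of r t] by (simp add: ennreal_mult mult_ac)
      finally show ?thesis
        using True by simp
    next
      case False
      then have "ennreal (L * h s) * ennreal (h r * exp (- L * (H s - H r))) * q r * indicator {0<..<s} r * indicator {0<..<t} s = 0" for s
        by (auto simp: indicator_def)
      then show ?thesis
        using False by (simp only:) simp
    qed
  qed
  finally have I1: "?I = ennreal (1 - exp (- L * H t)) * V + (\<integral>\<^sup>+r. ennreal (h r * (1 - exp (- L * (H t - H r)))) * q r * indicator {0<..<t} r \<partial>lborel)" .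
  \<comment> \<open>Adding the fixed-point formula for U completes the weights 1 - exp(...) to 1, in
    the initial term as well as in the source term.\<close>
  have "?I + ennreal (U t x) = (ennreal (1 - exp (- L * H t)) * V + ennreal (exp (- L * H t)) * V) +
     ((\<integral>\<^sup>+r. ennreal (h r * (1 - exp (- L * (H t - H r)))) * q r * indicator {0<..<t} r \<partial>lborel) + D)"
    unfolding I1 U_eq by (simp add: algebra_simps)
  also have "ennreal (1 - exp (- L * H t)) * V + ennreal (exp (- L * H t)) * V = V"
    using L_nonneg H_nonneg[of t] by (simp add: distrib_right[symmetric] ennreal_plus[symmetric] del: ennreal_plus)
  also have "(\<integral>\<^sup>+r. ennreal (h r * (1 - exp (- L * (H t - H r)))) * q r * indicator {0<..<t} r \<partial>lborel) + D = absorbed g t x"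
  proof -
    have "absorbed g t x = (\<integral>\<^sup>+s. ennreal (h s) * q s * indicator {0<..<t} s \<partial>lborel)"
      by (simp add: absorbed_def q_def)
    also have "\<dots> = (\<integral>\<^sup>+r. ennreal (h r * (1 - exp (- L * (H t - H r)))) * q r * indicator {0<..<t} r +
        ennreal (h r * exp (- L * (H t - H r))) * q r * indicator {0<..<t} r \<partial>lborel)"
    proof (rule nn_integral_cong)
      fix r
      have "ennreal (h r * (1 - exp (- L * (H t - H r)))) + ennreal (h r * exp (- L * (H t - H r))) = ennreal (h r)" if "r \<in> {0<..<t}"
      proof -
        define e where "e = exp (- L * (H t - H r))"
        have e: "0 \<le> e" "e \<le> 1"
          using that L_nonneg H_diff(2)[of r t] by (auto simp: e_def)
        have "ennreal (h r * (1 - e)) + ennreal (h r * e) = ennreal (h r * (1 - e) + h r * e)"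
          using e h_nonneg by simp
        then show ?thesis
          by (simp add: e_def algebra_simps)
      qed
      then show "ennreal (h r) * q r * indicator {0<..<t} r = ennreal (h r * (1 - exp (- L * (H t - H r)))) * q r * indicator {0<..<t} r +
          ennreal (h r * exp (- L * (H t - H r))) * q r * indicator {0<..<t} r"
        by (cases "r \<in> {0<..<t}") (auto simp: distrib_right[symmetric])
    qed
    also have "\<dots> = (\<integral>\<^sup>+r. ennreal (h r * (1 - exp (- L * (H t - H r)))) * q r * indicator {0<..<t} r \<partial>lborel) + D"
      unfolding D_def by (rule nn_integral_add) measurable
    finally show ?thesis ..
  qed
  finally have sum1: "?I + ennreal (U t x) = V + absorbed g t x" .
  \<comment> \<open>Second evaluation, pointwise in s, from the definition of
    \<open>g\<close>.\<close>
  have "?I = (\<integral>\<^sup>+s. ennreal (h s) * q s * indicator {0<..<t} s + ennreal (h s) * S (G t - G s) (\<lambda>y. ennreal (f (U s y))) x * indicator {0<..<t} s \<partial>lborel)"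
  proof (rule nn_integral_cong)
    fix s
    have "ennreal (L * h s) * S (G t - G s) (\<lambda>y. ennreal (U s y)) x = ennreal (h s) * S (G t - G s) (\<lambda>y. ennreal L * ennreal (U s y)) x"
      using L_nonneg h_nonneg by (subst S_cmult) (auto simp: ennreal_mult mult_ac)
    also have "(\<lambda>y. ennreal L * ennreal (U s y)) = (\<lambda>y. ennreal (g (U s y)) + ennreal (f (U s y)))"
      using L_nonneg U_range g_nonneg[OF U_range] f_nonneg[OF U_range]
      by (simp add: ennreal_mult[symmetric] ennreal_plus[symmetric] g_def del: ennreal_plus)
    also have "S (G t - G s) \<dots> x = q s + S (G t - G s) (\<lambda>y. ennreal (f (U s y))) x"
      unfolding q_def by (rule S_add) auto
    finally show "ennreal (L * h s) * S (G t - G s) (\<lambda>y. ennreal (U s y)) x * indicator {0<..<t} s =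
      ennreal (h s) * q s * indicator {0<..<t} s + ennreal (h s) * S (G t - G s) (\<lambda>y. ennreal (f (U s y))) x * indicator {0<..<t} s"
      by (simp add: distrib_left distrib_right)
  qed
  also have "\<dots> = absorbed g t x + absorbed f t x"
    unfolding absorbed_def q_def by (rule nn_integral_add) measurable
  finally have "absorbed g t x + (ennreal (U t x) + absorbed f t x) = absorbed g t x + V"
    using sum1 by (simp add: ac_simps)
  then show ?thesis
    \<comment> \<open>Finiteness allows the common summand \<open>absorbed g t x\<close> to be
      cancelled.\<close>
    using absorbed_g_finite[OF t, of x] by (auto simp: ennreal_add_left_cancel V_def)
qed

section \<open>Dependence of the solution on time\<close>

lemma nn_integral_abs_reflect:
  fixes k :: "'a \<Rightarrow> real"
  assumes [measurable]: "k \<in> borel_measurable borel"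
  shows "(\<integral>\<^sup>+y. ennreal \<bar>k (x - y)\<bar> \<partial>lborel) = (\<integral>\<^sup>+y. ennreal \<bar>k y\<bar> \<partial>lborel)"
  using nn_integral_lborel_affine[of "\<lambda>y. ennreal \<bar>k y\<bar>" "-1" x] by simp

text \<open>A perturbation bound in one-sided form, since the integrals are extended reals;
  exchanging the kernels gives the other side. The error does not depend on x.\<close>

lemma convolution_le:
  fixes k k' :: "'a \<Rightarrow> real" and F :: "'a \<Rightarrow> ennreal"
  assumes [measurable]: "k \<in> borel_measurable borel" "k' \<in> borel_measurable borel" "F \<in> borel_measurable borel"
    and k': "\<And>y. 0 \<le> k' y" and F: "\<And>y. F y \<le> ennreal C"
  shows "(\<integral>\<^sup>+y. ennreal (k (x - y)) * F y \<partial>lborel) \<le>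
    (\<integral>\<^sup>+y. ennreal (k' (x - y)) * F y \<partial>lborel) + ennreal C * (\<integral>\<^sup>+y. ennreal \<bar>k y - k' y\<bar> \<partial>lborel)"
proof -
  have "(\<integral>\<^sup>+y. ennreal (k (x - y)) * F y \<partial>lborel) \<le>
     (\<integral>\<^sup>+y. ennreal (k' (x - y)) * F y + ennreal C * ennreal \<bar>k (x - y) - k' (x - y)\<bar> \<partial>lborel)"
  proof (rule nn_integral_mono)
    fix y
    have "ennreal (k (x - y)) \<le> ennreal (k' (x - y)) + ennreal \<bar>k (x - y) - k' (x - y)\<bar>"
      unfolding ennreal_plus[OF k' abs_ge_zero, symmetric] by (rule ennreal_leI) simp
    then have "ennreal (k (x - y)) * F y \<le> (ennreal (k' (x - y)) + ennreal \<bar>k (x - y) - k' (x - y)\<bar>) * F y"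
      by (rule mult_right_mono) simp
    also have "\<dots> \<le> ennreal (k' (x - y)) * F y + ennreal C * ennreal \<bar>k (x - y) - k' (x - y)\<bar>"
      unfolding distrib_right
      by (intro add_left_mono, subst mult.commute, rule mult_right_mono[OF F]) simp
    finally show "ennreal (k (x - y)) * F y \<le> ennreal (k' (x - y)) * F y + ennreal C * ennreal \<bar>k (x - y) - k' (x - y)\<bar>" .
  qed
  also have "\<dots> = (\<integral>\<^sup>+y. ennreal (k' (x - y)) * F y \<partial>lborel) + ennreal C * (\<integral>\<^sup>+y. ennreal \<bar>k (x - y) - k' (x - y)\<bar> \<partial>lborel)"
    by (simp add: nn_integral_add nn_integral_cmult)
  finally show ?thesis
    using nn_integral_abs_reflect[of "\<lambda>y. k y - k' y" x] by simp
qed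

definition space_modulus :: "real \<Rightarrow> real \<Rightarrow> ennreal" where
  "space_modulus t t' = (\<integral>\<^sup>+y. ennreal \<bar>K (G t) y - K (G t') y\<bar> \<partial>lborel)"

text \<open>Extension by 0 outside (0, t), so that time integrals with different upper limits are
  compared over one common domain.\<close>

definition cut_kernel :: "real \<Rightarrow> real \<Rightarrow> 'a \<Rightarrow> real" where
  "cut_kernel t s y = (if 0 < s \<and> s < t then K (G t - G s) y else 0)"

definition time_modulus :: "real \<Rightarrow> real \<Rightarrow> ennreal" where
  "time_modulus t t' = (\<integral>\<^sup>+s. ennreal (h s) * (\<integral>\<^sup>+y. ennreal \<bar>cut_kernel t s y - cut_kernel t' s y\<bar> \<partial>lborel) \<partial>lborel)"

lemma cut_kernel_measurable[measurable (raw)]: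
  assumes [measurable]: "a \<in> borel_measurable N" "b \<in> borel_measurable N"
  shows "(\<lambda>z. cut_kernel t (a z) (b z)) \<in> borel_measurable N"
  unfolding cut_kernel_def by measurable

lemma cut_kernel_nonneg: "0 \<le> cut_kernel t s y"
  using G_strict_mono[of s t] by (auto simp: cut_kernel_def intro!: K_nonneg)

lemma cut_kernel_mass: "(\<integral>\<^sup>+y. ennreal (cut_kernel t s y) \<partial>lborel) \<le> 1"
  using G_strict_mono[of s t] K_mass[of "G t - G s"] by (cases "0 < s \<and> s < t") (auto simp: cut_kernel_def)

lemma absorbed_f_le: "absorbed f t x \<le> absorbed f t' x + ennreal (L * M) * time_modulus t t'"
proof -
  have eq: "absorbed f t x = (\<integral>\<^sup>+s. ennreal (h s) * (\<integral>\<^sup>+y. ennreal (cut_kernel t s (x - y)) * ennreal (f (U s y)) \<partial>lborel) \<partial>lborel)" for t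
    unfolding absorbed_def
  proof (rule nn_integral_cong)
    fix s
    show "ennreal (h s) * S (G t - G s) (\<lambda>y. ennreal (f (U s y))) x * indicator {0<..<t} s =
      ennreal (h s) * (\<integral>\<^sup>+y. ennreal (cut_kernel t s (x - y)) * ennreal (f (U s y)) \<partial>lborel)"
      by (cases "0 < s \<and> s < t") (auto simp: cut_kernel_def S_def)
  qed
  have "absorbed f t x \<le> (\<integral>\<^sup>+s. ennreal (h s) * (\<integral>\<^sup>+y. ennreal (cut_kernel t' s (x - y)) * ennreal (f (U s y)) \<partial>lborel) +
      ennreal (L * M) * (ennreal (h s) * (\<integral>\<^sup>+y. ennreal \<bar>cut_kernel t s y - cut_kernel t' s y\<bar> \<partial>lborel)) \<partial>lborel)"
    unfolding eq
  proof (rule nn_integral_mono)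
    fix s
    have "(\<integral>\<^sup>+y. ennreal (cut_kernel t s (x - y)) * ennreal (f (U s y)) \<partial>lborel) \<le>
        (\<integral>\<^sup>+y. ennreal (cut_kernel t' s (x - y)) * ennreal (f (U s y)) \<partial>lborel) +
        ennreal (L * M) * (\<integral>\<^sup>+y. ennreal \<bar>cut_kernel t s y - cut_kernel t' s y\<bar> \<partial>lborel)"
      by (rule convolution_le) (auto intro!: cut_kernel_nonneg ennreal_leI f_le U_range)
    from mult_left_mono[OF this, of "ennreal (h s)"]
    show "ennreal (h s) * (\<integral>\<^sup>+y. ennreal (cut_kernel t s (x - y)) * ennreal (f (U s y)) \<partial>lborel) \<le>
      ennreal (h s) * (\<integral>\<^sup>+y. ennreal (cut_kernel t' s (x - y)) * ennreal (f (U s y)) \<partial>lborel) +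
      ennreal (L * M) * (ennreal (h s) * (\<integral>\<^sup>+y. ennreal \<bar>cut_kernel t s y - cut_kernel t' s y\<bar> \<partial>lborel))"
      by (simp add: distrib_left mult.left_commute)
  qed
  also have "\<dots> = absorbed f t' x + ennreal (L * M) * time_modulus t t'"
    unfolding eq time_modulus_def by (simp add: nn_integral_add nn_integral_cmult)
  finally show ?thesis .
qed

text \<open>The mild equation at both times: the initial terms differ by at most a multiple of
  \<open>space_modulus\<close>, the absorptions by one of \<open>time_modulus\<close>. The finite
  \<open>absorbed f t x\<close> then cancels, and the remaining bound is uniform in x.\<close>

lemma U_le:
  assumes t: "0 < t" and t': "0 < t'"
  shows "ennreal (U t x) \<le> ennreal (U t' x) + (ennreal M * space_modulus t t' + ennreal (L * M) * time_modulus t' t)"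
proof -
  have "S (G t) (\<lambda>y. ennreal (v y)) x \<le> S (G t') (\<lambda>y. ennreal (v y)) x + ennreal M * space_modulus t t'"
    unfolding S_def space_modulus_def
    by (rule convolution_le) (auto intro!: K_nonneg G_pos t' ennreal_leI v_range)
  then have "absorbed f t x + ennreal (U t x) \<le> ennreal (U t' x) + absorbed f t' x + ennreal M * space_modulus t t'"
    using mild_equation[OF t, of x] mild_equation[OF t', of x] by (simp add: add.commute)
  also have "\<dots> \<le> ennreal (U t' x) + (absorbed f t x + ennreal (L * M) * time_modulus t' t) + ennreal M * space_modulus t t'"
    by (intro add_mono absorbed_f_le order_refl)
  also have "\<dots> = absorbed f t x + (ennreal (U t' x) + (ennreal M * space_modulus t t' + ennreal (L * M) * time_modulus t' t))"
    by (simp add: ac_simps)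
  finally show ?thesis
    using absorbed_f_finite[OF t, of x] by (auto simp: ennreal_add_left_cancel_le)
qed

lemma modulus_commute:
  "space_modulus t t' = space_modulus t' t" "time_modulus t t' = time_modulus t' t"
  by (simp_all add: space_modulus_def time_modulus_def abs_minus_commute)

lemma space_modulus_tendsto:
  assumes T: "T \<longlonglongrightarrow> t" and t: "0 < t"
  shows "(\<lambda>n. space_modulus (T n) t) \<longlonglongrightarrow> 0"
  unfolding space_modulus_def
  by (intro K_continuous G_pos t isCont_tendsto_compose[OF G_continuous[OF t] T])

lemma time_modulus_tendsto:
  assumes T: "T \<longlonglongrightarrow> t" and t: "0 < t"
  shows "(\<lambda>n. time_modulus (T n) t) \<longlonglongrightarrow> 0"
proof -
  \<comment> \<open>A common bound for all times involved: every cut kernel vanishes for s \<ge> B +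
    1, so 2 h on (0, B + 1) is a majorant.\<close>
  obtain B where B: "\<And>n. \<bar>T n\<bar> \<le> B"
    using convergent_imp_bounded[OF T] by (auto simp: bounded_iff)
  have "0 \<le> B"
    using B[of 0] by linarith
  with LIMSEQ_le_const2[OF T, of B] B have B0: "0 \<le> B" "t \<le> B"
    by (auto simp: abs_le_iff)
  have *: "(\<integral>\<^sup>+y. ennreal \<bar>cut_kernel a s y - cut_kernel b s y\<bar> \<partial>lborel) \<le> 2 * indicator {0<..<B + 1} s"
    if "a \<le> B" "b \<le> B" for a b s
  proof (cases "0 < s \<and> s < B + 1")
    case True
    have "(\<integral>\<^sup>+y. ennreal \<bar>cut_kernel a s y - cut_kernel b s y\<bar> \<partial>lborel) \<le>
      (\<integral>\<^sup>+y. ennreal (cut_kernel a s y) + ennreal (cut_kernel b s y) \<partial>lborel)"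
    proof (rule nn_integral_mono)
      fix y
      show "ennreal \<bar>cut_kernel a s y - cut_kernel b s y\<bar> \<le> ennreal (cut_kernel a s y) + ennreal (cut_kernel b s y)"
        unfolding ennreal_plus[OF cut_kernel_nonneg cut_kernel_nonneg, symmetric]
        using cut_kernel_nonneg[of a s y] cut_kernel_nonneg[of b s y] by (intro ennreal_leI) linarith
    qed
    also have "\<dots> = (\<integral>\<^sup>+y. ennreal (cut_kernel a s y) \<partial>lborel) + (\<integral>\<^sup>+y. ennreal (cut_kernel b s y) \<partial>lborel)"
      by (rule nn_integral_add) measurable
    also have "\<dots> \<le> 1 + 1"
      by (intro add_mono cut_kernel_mass)
    finally show ?thesis
      using True by simp
  qed (use that in \<open>auto simp: cut_kernel_def\<close>)
  have "(\<lambda>n. time_modulus (T n) t) \<longlonglongrightarrow> (\<integral>\<^sup>+s. 0 \<partial>(lborel :: real measure))"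
    unfolding time_modulus_def
  proof (rule nn_integral_dominated_convergence[where w="\<lambda>s. 2 * (ennreal (h s) * indicator {0<..<B + 1} s)"])
    show "AE s in lborel. ennreal (h s) * (\<integral>\<^sup>+y. ennreal \<bar>cut_kernel (T n) s y - cut_kernel t s y\<bar> \<partial>lborel)
        \<le> 2 * (ennreal (h s) * indicator {0<..<B + 1} s)" for n
      using mult_left_mono[OF *, of "T n" t "ennreal (h _)"] B[of n] B0
      by (intro AE_I2) (simp add: mult.left_commute abs_le_iff)
    show "(\<integral>\<^sup>+s. 2 * (ennreal (h s) * indicator {0<..<B + 1} s) \<partial>lborel) < \<infinity>"
      using B0 by (simp add: nn_integral_cmult H_diff ennreal_mult_less_top)
    show "AE s in lborel. (\<lambda>n. ennreal (h s) * (\<integral>\<^sup>+y. ennreal \<bar>cut_kernel (T n) s y - cut_kernel t s y\<bar> \<partial>lborel)) \<longlonglongrightarrow> 0"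
      \<comment> \<open>At s = t the cut kernels may jump, since \<open>T n\<close> can lie on
        either side of t; every other s is eventually on a fixed side.\<close>
      using AE_lborel_singleton[of t]
    proof eventually_elim
      case (elim s)
      have "(\<lambda>n. \<integral>\<^sup>+y. ennreal \<bar>cut_kernel (T n) s y - cut_kernel t s y\<bar> \<partial>lborel) \<longlonglongrightarrow> 0"
      proof -
        consider "s \<le> 0" | "0 < s" "s < t" | "t < s"
          using elim by linarith
        then show ?thesis
        proof cases
          case 1
          then show ?thesis by (simp add: cut_kernel_def)
        next
          case 2
          have "(\<lambda>n. \<integral>\<^sup>+y. ennreal \<bar>K (G (T n) - G s) y - K (G t - G s) y\<bar> \<partial>lborel) \<longlonglongrightarrow> 0"
            using 2 G_strict_mono[of s t]
            by (intro K_continuous tendsto_diff tendsto_const isCont_tendsto_compose[OF G_continuous[OF t] T]) auto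
          moreover have "\<forall>\<^sub>F n in sequentially. s < T n"
            using order_tendstoD(1)[OF T 2(2)] .
          then have "\<forall>\<^sub>F n in sequentially. (\<integral>\<^sup>+y. ennreal \<bar>K (G (T n) - G s) y - K (G t - G s) y\<bar> \<partial>lborel) =
              (\<integral>\<^sup>+y. ennreal \<bar>cut_kernel (T n) s y - cut_kernel t s y\<bar> \<partial>lborel)"
            by eventually_elim (use 2 in \<open>simp add: cut_kernel_def\<close>)
          ultimately show ?thesis
            by (rule Lim_transform_eventually)
        next
          case 3
          have "\<forall>\<^sub>F n in sequentially. T n < s"
            using order_tendstoD(2)[OF T 3] .
          then have "\<forall>\<^sub>F n in sequentially. 0 = (\<integral>\<^sup>+y. ennreal \<bar>cut_kernel (T n) s y - cut_kernel t s y\<bar> \<partial>lborel)"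
            by eventually_elim (use 3 in \<open>simp add: cut_kernel_def\<close>)
          then show ?thesis
            by (rule Lim_transform_eventually[OF tendsto_const])
        qed
      qed
      then show ?case
        using ennreal_tendsto_cmult[of "ennreal (h s)"] by fastforce
    qed
  qed measurable
  then show ?thesis by simp
qed

text \<open>The error in \<open>U_le\<close> is symmetric in the two times and free of x. Only
  positive limit times are covered: near time 0 the diffusion of a merely bounded function need not
  be continuous in the sup norm.\<close>

lemma U_uniformly_continuous:
  assumes T: "T \<longlonglongrightarrow> t" and t: "0 < t" and e: "0 < e"
  shows "\<forall>\<^sub>F n in sequentially. \<forall>x. \<bar>U (T n) x - U t x\<bar> \<le> e"
proof -
  let ?\<delta> = "\<lambda>n. ennreal M * space_modulus (T n) t + ennreal (L * M) * time_modulus (T n) t"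
  have "?\<delta> \<longlonglongrightarrow> ennreal M * 0 + ennreal (L * M) * 0"
    by (intro tendsto_add ennreal_tendsto_cmult space_modulus_tendsto time_modulus_tendsto T t) auto
  then have "\<forall>\<^sub>F n in sequentially. ?\<delta> n < ennreal e"
    using e by (intro order_tendstoD(2)) auto
  moreover have "\<forall>\<^sub>F n in sequentially. 0 < T n"
    using order_tendstoD(1)[OF T t] .
  ultimately show ?thesis
  proof eventually_elim
    case (elim n)
    show ?case
    proof
      fix x
      have "ennreal (U (T n) x) \<le> ennreal (U t x) + ennreal e"
        using U_le[OF elim(2) t, of x] elim(1) modulus_commute
        by (auto elim!: order_trans intro!: add_left_mono)
      moreover have "ennreal (U t x) \<le> ennreal (U (T n) x) + ennreal e"
        using U_le[OF t elim(2), of x] elim(1) modulus_commute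
        by (auto elim!: order_trans intro!: add_left_mono)
      ultimately have "U (T n) x \<le> U t x + e" "U t x \<le> U (T n) x + e"
        using U_range e by (simp_all add: ennreal_plus[symmetric] del: ennreal_plus)
      then show "\<bar>U (T n) x - U t x\<bar> \<le> e"
        by simp
    qed
  qed
qed

lemma U_0: "U 0 x = v x"
  using ennreal_U[of 0 x] v_range U_range by (simp add: step_def)

text \<open>Returns to real-valued integrals: finiteness of the absorption gives integrability and
  turns the sum in \<open>mild_equation\<close> into a difference.\<close>

lemma mild_equation_real:
  fixes x :: 'a
  assumes t: "0 < t"
  defines "q \<equiv> \<lambda>s. h s * (LINT y|lborel. K (G t - G s) (x - y) * f (U s y))"
  shows "set_integrable lborel {0<..<t} q"
    and "U t x = (LINT y|lborel. K (G t) (x - y) * v y) - (LINT s:{0<..<t}|lborel. q s)"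
proof -
  have f_U: "0 \<le> f (U s y)" for s y
    by (intro f_nonneg U_range)
  have S1: "(LINT y|lborel. K (G t - G s) (x - y) * f (U s y)) = enn2real (S (G t - G s) (\<lambda>y. ennreal (f (U s y))) x)"
    if s: "0 < s" "s < t" for s
    unfolding S_def using G_strict_mono[of s t] s f_U
    by (subst integral_eq_nn_integral) (auto intro!: arg_cong[of _ _ enn2real] nn_integral_cong simp: K_nonneg ennreal_mult)
  have S_le: "S (G t - G s) (\<lambda>y. ennreal (f (U s y))) x \<le> ennreal (L * M)" if s: "0 < s" "s < t" for s
  proof -
    have "S (G t - G s) (\<lambda>y. ennreal (f (U s y))) x \<le> S (G t - G s) (\<lambda>y. ennreal (L * M)) x"
      by (intro S_mono ennreal_leI f_le U_range)
    then show ?thesis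
      using G_strict_mono[of s t] s by (simp add: S_const)
  qed
  have q_eq: "ennreal (indicat_real {0<..<t} s *\<^sub>R q s) = ennreal (h s) * S (G t - G s) (\<lambda>y. ennreal (f (U s y))) x * indicator {0<..<t} s" for s
  proof (cases "s \<in> {0<..<t}")
    case True
    then have "S (G t - G s) (\<lambda>y. ennreal (f (U s y))) x < top"
      using le_less_trans[OF S_le] by auto
    then show ?thesis
      using True h_nonneg by (simp add: q_def S1 ennreal_mult)
  qed simp
  have q_nonneg: "0 \<le> indicat_real {0<..<t} s *\<^sub>R q s" for s
    using S1 h_nonneg by (auto simp: q_def indicator_def)
  have q_measurable[measurable]: "q \<in> borel_measurable borel"
    unfolding q_def by measurable
  have nn: "(\<integral>\<^sup>+s. ennreal (indicat_real {0<..<t} s *\<^sub>R q s) \<partial>lborel) = absorbed f t x"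
    unfolding q_eq absorbed_def ..
  show "set_integrable lborel {0<..<t} q"
    unfolding set_integrable_def
    using absorbed_f_finite[OF t, of x] q_nonneg nn by (intro integrableI_nonneg) auto
  have "(LINT s:{0<..<t}|lborel. q s) = enn2real (absorbed f t x)"
    unfolding set_lebesgue_integral_def nn[symmetric] using q_nonneg by (intro integral_eq_nn_integral) auto
  moreover have "(LINT y|lborel. K (G t) (x - y) * v y) = enn2real (S (G t) (\<lambda>y. ennreal (v y)) x)"
    unfolding S_def using v_range G_pos[OF t]
    by (subst integral_eq_nn_integral) (auto intro!: arg_cong[of _ _ enn2real] nn_integral_cong simp: K_nonneg ennreal_mult)
  ultimately show "U t x = (LINT y|lborel. K (G t) (x - y) * v y) - (LINT s:{0<..<t}|lborel. q s)"
    using absorbed_f_finite[OF t, of x] U_range by (simp flip: mild_equation[OF t] add: enn2real_plus)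
qed

end

section \<open>Existence of a global solution\<close>

lemma Linf_norm_le:
  assumes "f \<in> borel_measurable M" "AE x in M. \<bar>f x\<bar> \<le> C"
  shows "Linf_norm M f \<le> ereal C"
  unfolding Linf_norm_def using assms by (intro esssup_I) auto

text \<open>This depends on the measure being nonzero: over a null space the essential supremum is -
  \<infinity>.\<close>

lemma Linf_norm_lebesgue_nonneg:
  fixes f :: "'a::euclidean_space \<Rightarrow> real"
  assumes "f \<in> borel_measurable lebesgue"
  shows "0 \<le> Linf_norm lebesgue f"
proof -
  have "esssup (lebesgue :: 'a measure) (\<lambda>_. 0) \<le> Linf_norm lebesgue f"
    unfolding Linf_norm_def by (rule esssup_mono) auto
  moreover have "esssup (lebesgue :: 'a measure) (\<lambda>_. 0 :: ereal) = 0"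
    by (rule esssup_const) (simp add: emeasure_lborel_UNIV)
  ultimately show ?thesis
    by simp
qed

lemma Linf_bounded:
  assumes "f \<in> Linf M"
  obtains C where "0 \<le> C" "AE x in M. \<bar>f x\<bar> \<le> C"
proof (cases "Linf_norm M f")
  case (real r)
  have "AE x in M. ereal \<bar>f x\<bar> \<le> ereal r"
    using esssup_AE[of "\<lambda>x. ereal \<bar>f x\<bar>" M] real by (simp add: Linf_norm_def)
  then have "AE x in M. \<bar>f x\<bar> \<le> max 0 r"
    by eventually_elim auto
  then show ?thesis
    using that[of "max 0 r"] by simp
next
  case PInf
  then show ?thesis
    using assms by (simp add: Linf_def)
next
  case MInf
  have "AE x in M. ereal \<bar>f x\<bar> \<le> - \<infinity>"
    using esssup_AE[of "\<lambda>x. ereal \<bar>f x\<bar>" M] MInf by (simp add: Linf_norm_def)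
  then have "AE x in M. \<bar>f x\<bar> \<le> 0"
    by eventually_elim auto
  then show ?thesis
    using that[of 0] by simp
qed

text \<open>Sampling \<open>u\<close> at finitely many times yields simple functions of t, which
  converge in the sup norm wherever \<open>u\<close> is continuous.\<close>

lemma strongly_measurable_Linf_continuous:
  fixes u :: "real \<Rightarrow> 'a::euclidean_space \<Rightarrow> real"
  assumes T: "0 < T"
    and u: "\<And>t. t \<in> {0..T} \<Longrightarrow> u t \<in> Linf lebesgue"
    and cont: "\<And>X t e. X \<longlonglongrightarrow> t \<Longrightarrow> 0 < t \<Longrightarrow> 0 < e \<Longrightarrow> \<forall>\<^sub>F n in sequentially. \<forall>x. \<bar>u (X n) x - u t x\<bar> \<le> e"
  shows "strongly_measurable_Linf (lebesgue_on {0..T}) lebesgue u"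
proof -
  \<comment> \<open>Rounds t up to the grid of mesh T / (k + 1); on [0, T] this takes at most k + 2
    values, all in [0, T].\<close>
  define \<rho> where "\<rho> = (\<lambda>k t. T * of_int \<lceil>real (Suc k) * t / T\<rceil> / real (Suc k))"
  have \<rho>_range: "0 \<le> \<lceil>real (Suc k) * t / T\<rceil> \<and> \<lceil>real (Suc k) * t / T\<rceil> \<le> int (Suc k)" if "t \<in> {0..T}" for k t
  proof -
    have "real (Suc k) * t / T \<le> real (Suc k)"
      using that T by (simp add: divide_simps)
    moreover have "0 \<le> real (Suc k) * t / T"
      using that T by simp
    ultimately show ?thesis
      by (auto simp: ceiling_le_iff le_ceiling_iff simp del: of_nat_Suc)
  qed
  have \<rho>_in: "\<rho> k t \<in> {0..T}" if "t \<in> {0..T}" for k t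
  proof -
    have "0 \<le> real_of_int \<lceil>real (Suc k) * t / T\<rceil>" "real_of_int \<lceil>real (Suc k) * t / T\<rceil> \<le> real (Suc k)"
      using \<rho>_range[OF that, of k] by linarith+
    then show ?thesis
      using T by (simp add: \<rho>_def divide_le_eq del: of_nat_Suc)
  qed
  have \<rho>_simple: "simple_function (lebesgue_on {0..T}) (\<rho> k)" for k
  proof (rule simple_function_borel_measurable)
    have "\<rho> k \<in> borel_measurable borel"
      unfolding \<rho>_def by measurable
    then show "\<rho> k \<in> borel_measurable (lebesgue_on {0..T})"
      by (intro measurable_restrict_space1 measurable_completion) simp
    have "\<rho> k ` {0..T} \<subseteq> (\<lambda>i::int. T * of_int i / real (Suc k)) ` {0..int (Suc k)}"
      using \<rho>_range unfolding \<rho>_def by auto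
    from finite_subset[OF this] show "finite (\<rho> k ` space (lebesgue_on {0..T}))"
      by simp
  qed
  have \<rho>_lim: "(\<lambda>k. \<rho> k t) \<longlonglongrightarrow> t" for t
  proof (rule tendsto_sandwich)
    have "t \<le> \<rho> k t \<and> \<rho> k t \<le> t + T * (1 / real (Suc k))" for k
    proof -
      define n where "n = real (Suc k)"
      define c where "c = real_of_int \<lceil>n * t / T\<rceil>"
      have n: "0 < n" by (simp add: n_def)
      have "n * t / T \<le> c" "c \<le> n * t / T + 1"
        unfolding c_def by linarith+
      then have "n * t \<le> T * c" "T * c \<le> n * t + T"
        using T by (simp_all add: field_simps)
      then have "t \<le> T * c / n" "T * c / n \<le> t + T * (1 / n)"
        using n by (simp_all add: field_simps)
      then show ?thesis
        by (simp add: \<rho>_def c_def n_def)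
    qed
    then show "\<forall>\<^sub>F k in sequentially. t \<le> \<rho> k t" "\<forall>\<^sub>F k in sequentially. \<rho> k t \<le> t + T * (1 / real (Suc k))"
      by auto
    have "(\<lambda>k. t + T * (1 / real (Suc k))) \<longlonglongrightarrow> t + T * 0"
      by (intro tendsto_intros LIMSEQ_inverse_real_of_nat[unfolded inverse_eq_divide])
    then show "(\<lambda>k. t + T * (1 / real (Suc k))) \<longlonglongrightarrow> t"
      by simp
  qed simp
  have "AE t in lebesgue_on {0..T}. (\<lambda>k. Linf_norm lebesgue (\<lambda>x. u (\<rho> k t) x - u t x)) \<longlonglongrightarrow> 0"
  proof -
    \<comment> \<open>Continuity is available only at positive times; the time 0 is
      negligible.\<close>
    have "AE t::real in lebesgue. t \<noteq> 0"
      by (intro AE_completion AE_lborel_singleton)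
    then have "AE t in lebesgue. t \<in> {0..T} \<longrightarrow> (\<lambda>k. Linf_norm lebesgue (\<lambda>x. u (\<rho> k t) x - u t x)) \<longlonglongrightarrow> 0"
    proof eventually_elim
      case (elim t)
      show ?case
      proof
        assume t: "t \<in> {0..T}"
        have m: "(\<lambda>x. u (\<rho> k t) x - u t x) \<in> borel_measurable lebesgue" for k
          using u[OF t] u[OF \<rho>_in[OF t], of k] by (auto simp: Linf_def)
        show "(\<lambda>k. Linf_norm lebesgue (\<lambda>x. u (\<rho> k t) x - u t x)) \<longlonglongrightarrow> 0"
        proof (rule order_tendstoI)
          fix a :: ereal assume "a < 0"
          then show "\<forall>\<^sub>F k in sequentially. a < Linf_norm lebesgue (\<lambda>x. u (\<rho> k t) x - u t x)"
            by (intro always_eventually allI less_le_trans[OF _ Linf_norm_lebesgue_nonneg[OF m]])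
        next
          fix a :: ereal assume "0 < a"
          then obtain e where e: "0 < ereal e" "ereal e < a"
            using ereal_dense2 by blast
          have "\<forall>\<^sub>F k in sequentially. \<forall>x. \<bar>u (\<rho> k t) x - u t x\<bar> \<le> e"
            using t elim e by (intro cont \<rho>_lim) auto
          then show "\<forall>\<^sub>F k in sequentially. Linf_norm lebesgue (\<lambda>x. u (\<rho> k t) x - u t x) < a"
          proof eventually_elim
            case (elim k)
            then have "Linf_norm lebesgue (\<lambda>x. u (\<rho> k t) x - u t x) \<le> ereal e"
              by (intro Linf_norm_le m) auto
            with e show ?case
              by (auto intro: le_less_trans)
          qed
        qed
      qed
    qed
    then show ?thesis
      by (simp add: AE_restrict_space_iff)
  qed
  then show ?thesis
    unfolding strongly_measurable_Linf_def
  proof (intro exI[of _ "\<lambda>k t. u (\<rho> k t)"] conjI allI ballI)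
    show "simple_function (lebesgue_on {0..T}) (\<lambda>t. u (\<rho> k t))" for k
      by (rule simple_function_compose1[OF \<rho>_simple])
    show "u (\<rho> k t) \<in> Linf lebesgue" if "t \<in> space (lebesgue_on {0..T})" for k t
      using that by (intro u \<rho>_in) simp
  qed
qed

lemma heat_op_eq:
  fixes f f' :: "real ^ 'n \<Rightarrow> real"
  assumes "0 < \<alpha>" "0 < t" and [measurable]: "f \<in> borel_measurable lebesgue" "f' \<in> borel_measurable borel"
    and ff': "AE y in lborel. f y = f' y"
  shows "heat_op \<alpha> t f x = (LINT y|lborel. mixed_kernel \<alpha> t (x - y) * f' y)"
proof -
  have k: "(\<lambda>y. mixed_kernel \<alpha> t (x - y)) \<in> borel_measurable lborel"
    by measurable
  then have [measurable]: "(\<lambda>y. mixed_kernel \<alpha> t (x - y)) \<in> borel_measurable lebesgue"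
    by (rule measurable_completion)
  have [measurable]: "f' \<in> borel_measurable lebesgue"
    by (intro measurable_completion) simp
  have "heat_op \<alpha> t f x = (LINT y|lebesgue. mixed_kernel \<alpha> t (x - y) * f y)"
    using assms by (simp add: heat_op_def convol_def heat_kernel_eq)
  also have "\<dots> = (LINT y|lebesgue. mixed_kernel \<alpha> t (x - y) * f' y)"
    using AE_completion[OF ff'] by (intro integral_cong_AE) auto
  also have "\<dots> = (LINT y|lborel. mixed_kernel \<alpha> t (x - y) * f' y)"
    by (rule integral_completion) measurable
  finally show ?thesis .
qed

section \<open>Borel version of the weight and slope of the nonlinearity\<close>

text \<open>By completeness, null sets do not affect measurability; this carries the result for the
  Borel version back to the integrand containing \<open>h\<close> itself.\<close>

lemma borel_measurable_completion_cong_AE: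
  assumes f: "f \<in> borel_measurable (completion M)" and ae: "AE x in completion M. f x = g x"
  shows "g \<in> borel_measurable (completion M)"
proof (rule measurableI)
  fix A :: "'b set" assume "A \<in> sets borel"
  then have "f -` A \<inter> space (completion M) \<in> sets (completion M)"
    by (rule measurable_sets[OF f])
  then show "g -` A \<inter> space (completion M) \<in> sets (completion M)"
    by (rule completion.in_sets_AE[rotated]) (use ae in auto)
qed simp

lemma L1_loc_halfline_borel:
  assumes loc: "L1_loc_halfline h" and pos: "\<And>t. 0 < t \<Longrightarrow> 0 < h t"
  obtains h' where "positive_density h'" "AE s in lborel. 0 < s \<longrightarrow> h s = h' s"
proof -
  have int: "set_integrable lebesgue {0<..<T} h" if "0 < T" for T
    using loc that by (simp add: L1_loc_halfline_def)
  \<comment> \<open>Integrability is given on bounded intervals only; measurability on the whole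
    half-line is that of the limit of the truncations.\<close>
  have "(\<lambda>s. if 0 < s then h s else 0) \<in> borel_measurable lebesgue"
  proof (rule borel_measurable_LIMSEQ_real)
    show "(\<lambda>s. indicat_real {0<..<real (Suc n)} s *\<^sub>R h s) \<in> borel_measurable lebesgue" for n
      using int[of "real (Suc n)"] unfolding set_integrable_def by (intro borel_measurable_integrable) simp
    show "(\<lambda>n. indicat_real {0<..<real (Suc n)} s *\<^sub>R h s) \<longlonglongrightarrow> (if 0 < s then h s else 0)" for s
    proof (rule tendsto_eventually)
      obtain n0 :: nat where n0: "s < real n0"
        using reals_Archimedean2 by blast
      then show "\<forall>\<^sub>F n in sequentially. indicat_real {0<..<real (Suc n)} s *\<^sub>R h s = (if 0 < s then h s else 0)"
        by (intro eventually_sequentiallyI[of n0]) (auto simp: indicator_def)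
    qed
  qed
  from completion_ex_borel_measurable_real[OF this]
  obtain k where k[measurable]: "k \<in> borel_measurable borel" and hk: "AE s in lborel. (if 0 < s then h s else 0) = k s"
    by auto
  \<comment> \<open>The value 1 is substituted where \<open>k\<close> is not positive. For s > 0
    this happens only on a null set, because \<open>h\<close> is positive there.\<close>
  define h' where "h' = (\<lambda>s. if 0 < k s then k s else 1)"
  have [measurable]: "h' \<in> borel_measurable borel"
    unfolding h'_def by measurable
  have eq: "AE s in lborel. 0 < s \<longrightarrow> h s = h' s"
    using hk
  proof eventually_elim
    case (elim s)
    show ?case
    proof
      assume s: "0 < s"
      with elim have "h s = k s" by simp
      with pos[OF s] show "h s = h' s" by (simp add: h'_def)
    qed
  qed
  have h'_int: "set_integrable lborel {0<..<T} h'" if "0 < T" for T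
  proof -
    have m: "(\<lambda>s. indicat_real {0<..<T} s *\<^sub>R h' s) \<in> borel_measurable lborel"
      by measurable
    have "integrable lebesgue (\<lambda>s. indicat_real {0<..<T} s *\<^sub>R h' s)"
    proof (rule integrable_cong_AE_imp)
      show "integrable lebesgue (\<lambda>s. indicat_real {0<..<T} s *\<^sub>R h s)"
        using int[OF that] by (simp add: set_integrable_def)
      show "(\<lambda>s. indicat_real {0<..<T} s *\<^sub>R h' s) \<in> borel_measurable lebesgue"
        using m by (rule measurable_completion)
      show "AE s in lebesgue. indicat_real {0<..<T} s *\<^sub>R h s = indicat_real {0<..<T} s *\<^sub>R h' s"
        using AE_completion[OF eq] by eventually_elim (auto simp: indicator_def)
    qed
    then show ?thesis
      using integrable_completion[OF m] by (simp add: set_integrable_def)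
  qed
  have "positive_density h'"
  proof
    show "0 < h' s" for s
      by (simp add: h'_def)
  qed (use h'_int in auto)
  then show ?thesis
    using eq that by blast
qed

text \<open>The mean value theorem, the constant being the derivative of r^p at its largest point M.
  The case r = 0 is separate because the derivative rule is applied to positive bases only.\<close>

lemma power_nl_slope:
  assumes p: "1 < p" and r: "0 \<le> r" "r \<le> r'" "r' \<le> M"
  shows "power_nl p r' - power_nl p r \<le> p * M powr (p - 1) * (r' - r)"
proof -
  have eq: "power_nl p z = z powr p" if "0 \<le> z" for z
    using that by (cases "z = 0") (auto simp: power_nl_def powr_mult_base[of z "p - 1"] mult.commute)
  have le: "z powr (p - 1) \<le> M powr (p - 1)" if "0 \<le> z" "z \<le> M" for z
    using that p by (intro powr_mono2) auto
  consider "r = r'" | "r = 0" "0 < r'" | "0 < r" "r < r'"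
    using r by linarith
  then show ?thesis
  proof cases
    case 2
    have "power_nl p r' - power_nl p r = 1 * r' powr (p - 1) * r'"
      using 2 by (simp add: power_nl_def)
    also have "\<dots> \<le> p * M powr (p - 1) * r'"
      using p r 2 le[of r'] by (intro mult_right_mono mult_mono) auto
    finally show ?thesis
      using 2 by simp
  next
    case 3
    obtain z where z: "r < z" "z < r'" "r' powr p - r powr p = (r' - r) * (p * z powr (p - 1))"
    proof -
      have "((\<lambda>z. z powr p) has_real_derivative p * z powr (p - 1)) (at z)" if "r \<le> z" "z \<le> r'" for z
        using that 3 by (intro has_real_derivative_powr) simp
      from MVT2[OF 3(2) this] show ?thesis
        using that by blast
    qed
    have "(r' - r) * (p * z powr (p - 1)) \<le> (r' - r) * (p * M powr (p - 1))"
      using z 3 p r by (intro mult_left_mono le) auto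
    then show ?thesis
      using z 3 r by (simp add: eq mult_ac)
  qed simp
qed

theorem theorem3:
  fixes \<alpha> \<beta> p :: real and h :: "real \<Rightarrow> real" and u0 :: "real ^ 'n \<Rightarrow> real"
  assumes "0 < \<alpha>" and "\<alpha> < 2" and "0 \<le> \<beta>" and "1 < p"
    and "\<And>t. 0 < t \<Longrightarrow> 0 < h t"
    and "L1_loc_halfline h"
    and "u0 \<in> Linf lebesgue"
    and "AE x in lebesgue. 0 \<le> u0 x"
  shows "\<exists>u. global_solution \<alpha> \<beta> p h u0 u"
proof -
  obtain h' where "positive_density h'" and hh': "AE s in lborel. 0 < s \<longrightarrow> h s = h' s"
    using L1_loc_halfline_borel[OF assms(6,5)] by blast
  then interpret positive_density h' by simp
  obtain M where M: "0 \<le> M" "AE x in lebesgue. \<bar>u0 x\<bar> \<le> M"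
    using Linf_bounded assms(7) by blast
  have u0: "u0 \<in> borel_measurable lebesgue"
    using assms(7) by (simp add: Linf_def)
  from completion_ex_borel_measurable_real[OF this]
  obtain v' where [measurable]: "v' \<in> borel_measurable borel" and v': "AE x in lborel. u0 x = v' x"
    by auto
  \<comment> \<open>Clipping to [0, M] changes the initial value only on a null set and makes its
    bounds hold everywhere, as the iteration requires.\<close>
  define v where "v = (\<lambda>x. min M (max 0 (v' x)))"
  have v_measurable[measurable]: "v \<in> borel_measurable borel"
    unfolding v_def by measurable
  have u0v: "AE x in lborel. u0 x = v x"
    using v' M(2) assms(8) unfolding AE_completion_iff by eventually_elim (auto simp: v_def)
  \<comment> \<open>The semigroup law passes to nonnegative integrals because the product is
    integrable: one factor is bounded by a multiple of the L^1 norm of its symbol.\<close>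
  have semigroup: "(\<integral>\<^sup>+y. ennreal (mixed_kernel \<alpha> s (x - y)) * ennreal (mixed_kernel \<alpha> t y) \<partial>lborel) = ennreal (mixed_kernel \<alpha> (s + t) x)"
    if st: "0 < s" "0 < t" for s t and x :: "real ^ 'n"
  proof -
    have "\<bar>mixed_kernel \<alpha> s (x - y)\<bar> \<le> (LINT z|lborel. \<bar>symbol_exp \<alpha> s (z :: real ^ 'n)\<bar>) / (2 * pi) ^ DIM(real ^ 'n)" for y
      unfolding mixed_kernel_def abs_divide
      using cos_transform_bound[OF integrable_symbol_exp[OF st(1)], of \<alpha> "x - y"] by (simp add: divide_right_mono)
    then have i: "integrable lborel (\<lambda>y. mixed_kernel \<alpha> s (x - y) * mixed_kernel \<alpha> t y)"
      using assms(1,2) st by (intro integrable_mult_bounded[OF integrable_mixed_kernel]) auto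
    have "(\<integral>\<^sup>+y. ennreal (mixed_kernel \<alpha> s (x - y)) * ennreal (mixed_kernel \<alpha> t y) \<partial>lborel) =
        (\<integral>\<^sup>+y. ennreal (mixed_kernel \<alpha> s (x - y) * mixed_kernel \<alpha> t y) \<partial>lborel)"
      using assms(1,2) st by (intro nn_integral_cong) (simp add: ennreal_mult mixed_kernel_nonneg)
    also have "\<dots> = ennreal (LINT y|lborel. mixed_kernel \<alpha> s (x - y) * mixed_kernel \<alpha> t y)"
      using assms(1,2) st by (intro nn_integral_eq_integral i) (simp add: mixed_kernel_nonneg)
    also have "(LINT y|lborel. mixed_kernel \<alpha> s (x - y) * mixed_kernel \<alpha> t y) = mixed_kernel \<alpha> (s + t) x"
      using assms(1,2) st by (rule mixed_kernel_semigroup)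
    finally show ?thesis .
  qed
  interpret evolution h' "mixed_kernel \<alpha> :: real \<Rightarrow> real ^ 'n \<Rightarrow> real" "clock \<beta>" v "power_nl p" M "p * M powr (p - 1)"
  proof
    show "(\<lambda>n. \<integral>\<^sup>+x. ennreal \<bar>mixed_kernel \<alpha> (T n) x - mixed_kernel \<alpha> t (x :: real ^ 'n)\<bar> \<partial>lborel) \<longlonglongrightarrow> 0"
      if "T \<longlonglongrightarrow> t" "0 < t" for T t
      using mixed_kernel_L1_continuous[OF assms(1,2)] that by blast
    show "clock \<beta> \<in> borel_measurable borel"
      unfolding clock_def[abs_def] by measurable
    show "clock \<beta> s < clock \<beta> t" if "0 \<le> s" "s < t" for s t
      using that assms(3) powr_less_mono2[of "\<beta> + 1" s t] by (simp add: clock_def divide_strict_right_mono)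
    show "isCont (clock \<beta>) t" if "0 < t" for t
      unfolding clock_def[abs_def] using that assms(3) by (intro continuous_intros) auto
    show "power_nl p \<in> borel_measurable borel"
      unfolding power_nl_def[abs_def] by measurable
    show "continuous_on {0..M} (power_nl p)"
      unfolding power_nl_def[abs_def] using assms(4) by (intro continuous_intros continuous_on_powr') auto
    show "power_nl p r' - power_nl p r \<le> p * M powr (p - 1) * (r' - r)" if "0 \<le> r" "r \<le> r'" "r' \<le> M" for r r'
      using power_nl_slope[OF assms(4) that] .
  qed (use assms(1-4) M semigroup in \<open>auto simp: mixed_kernel_nonneg nn_integral_mixed_kernel clock_def power_nl_def v_def\<close>)
  have U_m: "U t \<in> borel_measurable borel" for t
    by measurable
  have U_m': "U t \<in> borel_measurable lebesgue" for t
    by (intro measurable_completion) (simp add: U_m)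
  have U_norm: "Linf_norm lebesgue (U t) \<le> ereal M" for t
    using U_range by (intro Linf_norm_le U_m') (simp add: abs_le_iff add_increasing)
  have U_Linf: "U t \<in> Linf lebesgue" for t
    using U_m'[of t] le_less_trans[OF U_norm[of t], of \<infinity>] by (simp add: Linf_def)
  have "Linf_solution \<alpha> \<beta> p h u0 T U" if T: "0 < T" for T
    unfolding Linf_solution_def
  proof (intro conjI ballI)
    show "U \<in> Linf_Linf (lebesgue_on {0..T}) lebesgue"
      unfolding Linf_Linf_def using U_Linf U_norm
      by (auto intro!: strongly_measurable_Linf_continuous T U_uniformly_continuous)
    fix t assume "t \<in> {0..T}"
    then consider "t = 0" | "0 < t" by fastforce
    then show "AE x in lebesgue.
        set_integrable lebesgue {0<..<t} (\<lambda>s. h s * heat_op \<alpha> (clock \<beta> t - clock \<beta> s) (\<lambda>y. power_nl p (U s y)) x) \<and>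
        U t x = heat_op \<alpha> (clock \<beta> t) u0 x -
          (LINT s:{0<..<t}|lebesgue. h s * heat_op \<alpha> (clock \<beta> t - clock \<beta> s) (\<lambda>y. power_nl p (U s y)) x)"
    proof cases
      \<comment> \<open>At time 0 the heat operator is the identity and the time integral is empty;
        what remains is v = u0, which holds almost everywhere.\<close>
      case 1
      have "AE x in lebesgue. u0 x = v x"
        using u0v by (rule AE_completion)
      then show ?thesis
        by eventually_elim (simp add: 1 U_0 G_0 heat_op_def set_integrable_def set_lebesgue_integral_def)
    next
      case 2
      show ?thesis
      \<comment> \<open>For t > 0 the equation holds at every x, since \<open>u0\<close> and
        \<open>h\<close> enter only through integrals and may be exchanged for their Borel
        versions.\<close>
      proof (rule AE_I2)
        fix x :: "real ^ 'n"
        let ?F = "\<lambda>s. indicat_real {0<..<t} s *\<^sub>R (h s * heat_op \<alpha> (clock \<beta> t - clock \<beta> s) (\<lambda>y. power_nl p (U s y)) x)"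
        let ?q = "\<lambda>s. h' s * (LINT y|lborel. mixed_kernel \<alpha> (clock \<beta> t - clock \<beta> s) (x - y) * power_nl p (U s y))"
        let ?F' = "\<lambda>s. indicat_real {0<..<t} s *\<^sub>R ?q s"
        note eq = mild_equation_real[OF 2, of x]
        have F'_int: "integrable lborel ?F'"
          using eq(1) by (simp add: set_integrable_def)
        have F'_m: "?F' \<in> borel_measurable lborel"
          using F'_int by (rule borel_measurable_integrable)
        have "AE s in lborel. ?F' s = ?F s"
          using hh'
        proof eventually_elim
          case (elim s)
          show ?case
          proof (cases "s \<in> {0<..<t}")
            case True
            then have "heat_op \<alpha> (clock \<beta> t - clock \<beta> s) (\<lambda>y. power_nl p (U s y)) x =
              (LINT y|lborel. mixed_kernel \<alpha> (clock \<beta> t - clock \<beta> s) (x - y) * power_nl p (U s y))"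
              using assms(1) G_strict_mono[of s t] by (intro heat_op_eq measurable_completion) auto
            then show ?thesis
              using True elim by simp
          qed simp
        qed
        then have ae: "AE s in lebesgue. ?F' s = ?F s"
          by (rule AE_completion)
        have F'_m': "?F' \<in> borel_measurable lebesgue"
          using F'_m by (rule measurable_completion)
        have F'_int': "integrable lebesgue ?F'"
          using F'_int integrable_completion[OF F'_m] by simp
        have F_m: "?F \<in> borel_measurable lebesgue"
          by (rule borel_measurable_completion_cong_AE[OF F'_m' ae])
        have "integrable lebesgue ?F"
          by (rule integrable_cong_AE_imp[OF F'_int' F_m ae])
        moreover have "(LINT s|lebesgue. ?F s) = (LINT s|lborel. ?F' s)"
          using integral_cong_AE[OF F'_m' F_m ae] integral_completion[OF F'_m] by simp
        moreover have "heat_op \<alpha> (clock \<beta> t) u0 x = (LINT y|lborel. mixed_kernel \<alpha> (clock \<beta> t) (x - y) * v y)"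
          using assms(1) G_pos[OF 2] u0 u0v by (intro heat_op_eq) auto
        ultimately show "set_integrable lebesgue {0<..<t} (\<lambda>s. h s * heat_op \<alpha> (clock \<beta> t - clock \<beta> s) (\<lambda>y. power_nl p (U s y)) x) \<and>
          U t x = heat_op \<alpha> (clock \<beta> t) u0 x -
          (LINT s:{0<..<t}|lebesgue. h s * heat_op \<alpha> (clock \<beta> t - clock \<beta> s) (\<lambda>y. power_nl p (U s y)) x)"
          using eq(2) by (simp add: set_integrable_def set_lebesgue_integral_def)
      qed
    qed
  qed
  then show ?thesis
    unfolding global_solution_def by blast
qed

end
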